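(* Let $R=\bigoplus_{j\ge 0}R_j$ be a standard graded algebra over a field $K$ (no assumption is made on $K$), let $d$ be a positive integer, and let $\mathbb{A}(R_1)$ be the affine space of linear forms of $R$, i.e. the finite-dimensional $K$-vector space $R_1$ regarded as an affine space. Then there exist finitely many proper linear subspaces $L_1,\dots,L_m$ of $\mathbb{A}(R_1)$ such that for every linear form $l\in R_1$ with $l\notin L_1\cup\dots\cup L_m$ we have \[ \dim_K (R/lR)_d\leq (\dim_K R_d)_{\langle d \rangle }. \]
   Context: A standard graded algebra over $K$ is a $K$-algebra of the form $K[X_1,\dots,X_n]/I$ with $I$ a homogeneous ideal (all variables of degree 1). Given a positive integer $d$, every non-negative integer $c$ can be written uniquely as $c=\binom{k_d}{d}+\binom{k_{d-1}}{d-1}+\dots+\binom{k_1}{1}$ with $k_d>k_{d-1}>\dots>k_1\ge 0$ (the $d$-th Macaulay representation of $c$). One defines $c_{\langle d\rangle}=\binom{k_d-1}{d}+\binom{k_{d-1}-1}{d-1}+\dots+\binom{k_1-1}{1}$. Convention: $\binom{a}{b}=0$ whenever $a<b$ (including negative $a$). *)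

theory Defs
  imports
    "HOL-Algebra.Embedded_Algebras"
    "HOL-Algebra.QuotRing"
    "HOL-Library.Poly_Mapping"
begin

section \<open>Standard graded algebras\<close>

text \<open>
  A monomial is a finitely supported exponent vector \<^typ>\<open>nat \<Rightarrow>\<^sub>0 nat\<close>, a polynomial a finitely
  supported coefficient function on monomials, with the convolution product of
  \<^theory>\<open>HOL-Library.Poly_Mapping\<close>. The variables are indexed by \<open>0, \<dots>, n - 1\<close>.
\<close>

type_synonym 'k mpoly = "(nat \<Rightarrow>\<^sub>0 nat) \<Rightarrow>\<^sub>0 'k"

definition mpoly_ring :: "nat \<Rightarrow> 'k::field mpoly ring" where
  "mpoly_ring n =
    \<lparr>carrier = {p. \<forall>m \<in> Poly_Mapping.keys p. Poly_Mapping.keys m \<subseteq> {..<n}},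
     monoid.mult = (*), one = 1, ring.zero = 0, add = (+)\<rparr>"

definition monom_degree :: "(nat \<Rightarrow>\<^sub>0 nat) \<Rightarrow> nat" where
  "monom_degree m = (\<Sum>i \<in> Poly_Mapping.keys m. Poly_Mapping.lookup m i)"

text \<open>The zero polynomial is a form of every degree.\<close>

definition forms :: "nat \<Rightarrow> nat \<Rightarrow> 'k::field mpoly set" where
  "forms n j = {p \<in> carrier (mpoly_ring n). \<forall>m \<in> Poly_Mapping.keys p. monom_degree m = j}"

definition homogeneous_ideal :: "nat \<Rightarrow> 'k::field mpoly set \<Rightarrow> bool" where
  "homogeneous_ideal n I \<longleftrightarrow> (\<exists>G. G \<subseteq> (\<Union>j. forms n j) \<and> I = Idl\<^bsub>mpoly_ring n\<^esub> G)"

text \<open>Image of a subset \<open>E\<close> of \<open>R\<close> under the projection \<open>R \<rightarrow> R / J\<close>.\<close>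

definition quot_image :: "('a, 'b) ring_scheme \<Rightarrow> 'a set \<Rightarrow> 'a set \<Rightarrow> 'a set set" where
  "quot_image R J E = (\<lambda>x. J +>\<^bsub>R\<^esub> x) ` E"

definition std_alg :: "nat \<Rightarrow> 'k::field mpoly set \<Rightarrow> 'k mpoly set ring" where
  "std_alg n I = mpoly_ring n Quot I"

definition std_alg_part :: "nat \<Rightarrow> 'k::field mpoly set \<Rightarrow> nat \<Rightarrow> 'k mpoly set set" where
  "std_alg_part n I j = quot_image (mpoly_ring n) I (forms n j)"

text \<open>
  The \<open>K\<close>-vector space structure is the one induced by the image of \<open>K\<close> in the ring, as in
  \<^theory>\<open>HOL-Algebra.Embedded_Algebras\<close>. If \<open>I\<close> is the unit ideal, this image is \<open>{0}\<close>, as is the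
  whole algebra, and its only dimension is still \<open>0\<close>.
\<close>

definition std_alg_scalars :: "nat \<Rightarrow> 'k::field mpoly set \<Rightarrow> 'k mpoly set set" where
  "std_alg_scalars n I = quot_image (mpoly_ring n) I (range (Poly_Mapping.single 0))"

definition linear_subspace :: "('a, 'b) ring_scheme \<Rightarrow> 'a set \<Rightarrow> 'a set \<Rightarrow> bool" where
  "linear_subspace R K L \<longleftrightarrow>
     subgroup L (add_monoid R) \<and> (\<forall>k \<in> K. \<forall>v \<in> L. k \<otimes>\<^bsub>R\<^esub> v \<in> L)"

definition dim_part :: "nat \<Rightarrow> 'k::field mpoly set \<Rightarrow> nat \<Rightarrow> nat" where
  "dim_part n I j = ring.dim (std_alg n I) (std_alg_scalars n I) (std_alg_part n I j)"

text \<open>\<open>dim\<^sub>K (R / l R)\<^sub>j\<close> for \<open>R = std_alg n I\<close>.\<close>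

definition dim_section_part ::
  "nat \<Rightarrow> 'k::field mpoly set \<Rightarrow> 'k mpoly set \<Rightarrow> nat \<Rightarrow> nat" where
  "dim_section_part n I l j =
    (let R = std_alg n I; J = PIdl\<^bsub>R\<^esub> l in
     ring.dim (R Quot J)
       (quot_image R J (std_alg_scalars n I)) (quot_image R J (std_alg_part n I j)))"

lemma keys_mult_vars:
  fixes p q :: "'k::field mpoly"
  assumes "\<forall>m \<in> Poly_Mapping.keys p. Poly_Mapping.keys m \<subseteq> A"
    and "\<forall>m \<in> Poly_Mapping.keys q. Poly_Mapping.keys m \<subseteq> A"
  shows "\<forall>m \<in> Poly_Mapping.keys (p * q). Poly_Mapping.keys m \<subseteq> A"
proof
  fix m assume "m \<in> Poly_Mapping.keys (p * q)"
  then obtain a b where "m = a + b" "a \<in> Poly_Mapping.keys p" "b \<in> Poly_Mapping.keys q"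
    using keys_mult[of p q] by auto
  moreover have "Poly_Mapping.keys (a + b) \<subseteq> Poly_Mapping.keys a \<union> Poly_Mapping.keys b"
    by (rule Poly_Mapping.keys_add)
  ultimately show "Poly_Mapping.keys m \<subseteq> A" using assms by fastforce
qed

lemma cring_mpoly_ring: "cring (mpoly_ring n :: 'k::field mpoly ring)"
proof (rule cringI)
  show "abelian_group (mpoly_ring n :: 'k mpoly ring)"
  proof (rule abelian_groupI)
    fix x y :: "'k mpoly"
    assume "x \<in> carrier (mpoly_ring n)" "y \<in> carrier (mpoly_ring n)"
    then show "x \<oplus>\<^bsub>mpoly_ring n\<^esub> y \<in> carrier (mpoly_ring n)"
      using Poly_Mapping.keys_add[of x y] by (auto simp: mpoly_ring_def)
  next
    fix x :: "'k mpoly"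
    assume "x \<in> carrier (mpoly_ring n)"
    then show "\<exists>y\<in>carrier (mpoly_ring n). y \<oplus>\<^bsub>mpoly_ring n\<^esub> x = \<zero>\<^bsub>mpoly_ring n\<^esub>"
      by (intro bexI[of _ "- x"]) (auto simp: mpoly_ring_def)
  qed (auto simp: mpoly_ring_def algebra_simps)
  show "comm_monoid (mpoly_ring n :: 'k mpoly ring)"
  proof (rule comm_monoidI)
    fix x y :: "'k mpoly"
    assume "x \<in> carrier (mpoly_ring n)" "y \<in> carrier (mpoly_ring n)"
    then show "x \<otimes>\<^bsub>mpoly_ring n\<^esub> y \<in> carrier (mpoly_ring n)"
      using keys_mult_vars[of x "{..<n}" y] by (simp add: mpoly_ring_def)
  qed (auto simp: mpoly_ring_def algebra_simps)
qed (auto simp: mpoly_ring_def algebra_simps)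


section \<open>Macaulay representations\<close>

text \<open>
  \<open>k i\<close> is the top entry of the \<open>i\<close>-th binomial coefficient. Values outside \<open>{1..d}\<close> are set to
  \<open>0\<close> so that the representation is unique as a function.
\<close>

definition is_macaulay_rep :: "nat \<Rightarrow> nat \<Rightarrow> (nat \<Rightarrow> nat) \<Rightarrow> bool" where
  "is_macaulay_rep d c k \<longleftrightarrow>
     strict_mono_on {1..d} k \<and> (\<forall>i. i \<notin> {1..d} \<longrightarrow> k i = 0) \<and> c = (\<Sum>i = 1..d. k i choose i)"

definition macaulay_rep :: "nat \<Rightarrow> nat \<Rightarrow> nat \<Rightarrow> nat" where
  "macaulay_rep d c = (THE k. is_macaulay_rep d c k)"

text \<open>
  For \<open>k\<^sub>i = 0\<close> the truncated difference is \<open>0\<close> instead of \<open>-1\<close>; both binomial coefficients vanish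
  since \<open>i \<ge> 1\<close>.
\<close>

definition macaulay_lower :: "nat \<Rightarrow> nat \<Rightarrow> nat" where
  "macaulay_lower d c = (\<Sum>i = 1..d. (macaulay_rep d c i - 1) choose i)"

lemma macaulay_sum_less:
  assumes "strict_mono_on {1..d} k" "\<forall>i \<in> {1..d}. k i < N"
  shows "(\<Sum>i = 1..d. k i choose i) < N choose d"
  using assms
proof (induction d arbitrary: N)
  case 0
  then show ?case by simp
next
  case (Suc d)
  have "strict_mono_on {1..d} k"
    using Suc.prems(1) by (auto simp: strict_mono_on_def)
  moreover have "\<forall>i \<in> {1..d}. k i < k (Suc d)"
    using Suc.prems(1) by (auto simp: strict_mono_on_def)
  ultimately have "(\<Sum>i = 1..d. k i choose i) < k (Suc d) choose d"
    by (rule Suc.IH)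
  then have "(\<Sum>i = 1..Suc d. k i choose i) < Suc (k (Suc d)) choose Suc d"
    by simp
  also have "\<dots> \<le> N choose Suc d"
    using Suc.prems(2) by (intro binomial_right_mono) (simp add: Suc_le_eq)
  finally show ?case .
qed

lemma macaulay_rep_unique:
  assumes "strict_mono_on {1..d} k" "strict_mono_on {1..d} k'"
    and "(\<Sum>i = 1..d. k i choose i) = (\<Sum>i = 1..d. k' i choose i)"
  shows "\<forall>i \<in> {1..d}. k i = k' i"
  using assms
proof (induction d)
  case 0
  then show ?case by simp
next
  case (Suc d)
  have le: "b (Suc d) \<le> a (Suc d)"
    if "strict_mono_on {1..Suc d} a"
      and "(\<Sum>i = 1..Suc d. a i choose i) = (\<Sum>i = 1..Suc d. b i choose i)" for a b :: "nat \<Rightarrow> nat"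
  proof (rule ccontr)
    assume "\<not> ?thesis"
    moreover have "a i \<le> a (Suc d)" if "i \<in> {1..Suc d}" for i
      using \<open>strict_mono_on {1..Suc d} a\<close> that
      by (cases "i = Suc d") (auto simp: strict_mono_on_def intro: less_imp_le)
    ultimately have "\<forall>i \<in> {1..Suc d}. a i < b (Suc d)" by fastforce
    from macaulay_sum_less[OF that(1) this] that(2) show False by simp
  qed
  have top: "k (Suc d) = k' (Suc d)"
    using le[of k k'] le[of k' k] Suc.prems by simp
  have "\<forall>i \<in> {1..d}. k i = k' i"
  proof (rule Suc.IH)
    show "strict_mono_on {1..d} k" "strict_mono_on {1..d} k'"
      using Suc.prems(1,2) by (auto simp: strict_mono_on_def)
    show "(\<Sum>i = 1..d. k i choose i) = (\<Sum>i = 1..d. k' i choose i)"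
      using Suc.prems(3) top by simp
  qed
  with top show ?case by (auto simp: le_Suc_eq)
qed

lemma macaulay_rep_exists:
  assumes "c < N choose d"
  shows "\<exists>k. is_macaulay_rep d c k \<and> (\<forall>i \<in> {1..d}. k i < N)"
  using assms
proof (induction d arbitrary: c N)
  case 0
  then show ?case
    by (intro exI[of _ "\<lambda>_. 0"]) (auto simp: is_macaulay_rep_def strict_mono_on_def)
next
  case (Suc d)
  let ?M = "{m. m < N \<and> m choose Suc d \<le> c}"
  define m where "m = Max ?M"
  have "0 < N" using Suc.prems by (cases N) auto
  then have "0 \<in> ?M" by simp
  then have m: "m \<in> ?M" unfolding m_def by (intro Max_in) auto
  have "c < Suc m choose Suc d"
  proof (rule ccontr)
    assume *: "\<not> ?thesis"
    have "Suc m < N"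
    proof (rule ccontr)
      assume "\<not> Suc m < N"
      with m have "Suc m = N" by auto
      with * Suc.prems show False by simp
    qed
    with * have "Suc m \<in> ?M" by simp
    then have "Suc m \<le> m" unfolding m_def by (intro Max_ge) auto
    then show False by simp
  qed
  then have "c - (m choose Suc d) < m choose d" using m by auto
  from Suc.IH[OF this] obtain k where
    k: "is_macaulay_rep d (c - (m choose Suc d)) k" "\<forall>i \<in> {1..d}. k i < m" by blast
  have "strict_mono_on {1..Suc d} (k(Suc d := m))"
    using k by (auto simp: is_macaulay_rep_def strict_mono_on_def le_Suc_eq)
  moreover have "(\<Sum>i = 1..Suc d. (k(Suc d := m)) i choose i) = c"
  proof -
    have "(\<Sum>i = 1..d. (k(Suc d := m)) i choose i) = (\<Sum>i = 1..d. k i choose i)"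
      by (rule sum.cong) auto
    also have "\<dots> = c - (m choose Suc d)" using k(1) by (simp add: is_macaulay_rep_def)
    finally show ?thesis using m by simp
  qed
  moreover have "\<forall>i. i \<notin> {1..Suc d} \<longrightarrow> (k(Suc d := m)) i = 0"
    using k(1) by (auto simp: is_macaulay_rep_def)
  moreover have "\<forall>i \<in> {1..Suc d}. (k(Suc d := m)) i < N"
    using k(2) m by (auto simp: le_Suc_eq intro: less_trans)
  ultimately show ?case unfolding is_macaulay_rep_def by blast
qed

lemma macaulay_rep_ex1:
  assumes "d > 0"
  shows "\<exists>!k. is_macaulay_rep d c k"
proof -
  have "c < (c + d) choose d"
    using assms
  proof (induction c)
    case (Suc c)
    obtain e where e: "d = Suc e" using Suc.prems by (cases d) auto
    have "0 < (c + d) choose e" using e by simp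
    moreover have "(Suc c + d) choose d = ((c + d) choose e) + ((c + d) choose d)" using e by simp
    ultimately show ?case using Suc by linarith
  qed simp
  then obtain k where k: "is_macaulay_rep d c k" using macaulay_rep_exists by blast
  show ?thesis
  proof (rule ex1I[of "is_macaulay_rep d c", OF k])
    fix k' assume k': "is_macaulay_rep d c k'"
    have "\<forall>i \<in> {1..d}. k' i = k i"
      using k k' by (intro macaulay_rep_unique) (auto simp: is_macaulay_rep_def)
    with k k' show "k' = k"
      by (intro ext) (metis is_macaulay_rep_def)
  qed
qed

end

theory Submission
  imports Defs "HOL-Library.Set_Algebras"
begin

text \<open>
  Write \<open>c\<close> for \<open>dim R\<^sub>d\<close> and \<open>c\<^sub>l\<close> for \<open>dim (R/lR)\<^sub>d\<close>, and call a property of linear forms generic if it holds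
  off a finite union of proper subspaces of \<open>R\<^sub>1\<close>. Let \<open>M\<close> be the least number such that \<open>c\<^sub>l \<le> M\<close>
  generically. If \<open>M > 0\<close>, the forms with \<open>c\<^sub>l = M\<close> are not covered by finitely many proper subspaces,
  so there is such a form \<open>h \<noteq> 0\<close>, and then a further one \<open>l\<close> that is generic for both \<open>R/hR\<close> in degree \<open>d\<close>
  and \<open>R/(0 : h)\<close> in degree \<open>d - 1\<close>. As in Green's proof, the exact sequence
  \<open>(R/(lR : h))\<^sub>d\<^sub>-\<^sub>1 \<rightarrow> (R/lR)\<^sub>d \<rightarrow> (R/(l,h)R)\<^sub>d\<close> and induction on \<open>d\<close> and \<open>dim R\<^sub>1\<close> give
  \<open>M \<le> M\<^sub>\<langle>\<^sub>d\<^sub>\<rangle> + (c - M)\<^sub>\<langle>\<^sub>d\<^sub>-\<^sub>1\<^sub>\<rangle>\<close>, which forces \<open>M \<le> c\<^sub>\<langle>\<^sub>d\<^sub>\<rangle>\<close>. Choosing \<open>M\<close> in this way replaces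
  semicontinuity, so the field may be arbitrary and the exceptional set consists of linear subspaces.
\<close>

section \<open>Numerical properties of the lowered Macaulay representation\<close>

lemma macaulay_lower_eq:
  assumes "is_macaulay_rep d c k"
  shows "macaulay_lower d c = (\<Sum>i = 1..d. (k i - 1) choose i)"
proof (cases "d > 0")
  case True
  then have "macaulay_rep d c = k"
    unfolding macaulay_rep_def using assms macaulay_rep_ex1 by (intro the1_equality) auto
  then show ?thesis by (simp add: macaulay_lower_def)
qed (simp add: macaulay_lower_def)

lemma macaulay_lower_0_left [simp]: "macaulay_lower 0 c = 0"
  by (simp add: macaulay_lower_def)

text \<open>The bound on \<open>r\<close> keeps the entries of its representation below
  \<open>N\<close>, so \<open>N\<close> can be put on top of them. The inductions on
  \<open>d\<close> below run through this recursion.\<close>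

lemma macaulay_lower_split:
  assumes "r < N choose d"
  shows "macaulay_lower (Suc d) ((N choose Suc d) + r) = ((N - 1) choose Suc d) + macaulay_lower d r"
proof -
  obtain k where k: "is_macaulay_rep d r k" "\<forall>i \<in> {1..d}. k i < N"
    using macaulay_rep_exists[OF assms] by blast
  have s: "(\<Sum>i = 1..d. f ((k(Suc d := N)) i) i) = (\<Sum>i = 1..d. f (k i) i)" for f :: "nat \<Rightarrow> nat \<Rightarrow> nat"
    by (rule sum.cong) auto
  have "is_macaulay_rep (Suc d) ((N choose Suc d) + r) (k(Suc d := N))"
    using k s[of "\<lambda>a i. a choose i"]
    by (auto simp: is_macaulay_rep_def strict_mono_on_def le_Suc_eq)
  from macaulay_lower_eq[OF this] macaulay_lower_eq[OF k(1)] s[of "\<lambda>a i. (a - 1) choose i"]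
  show ?thesis by simp
qed

text \<open>Counting upwards in \<open>c\<close>: once the remainder reaches
  \<open>N choose d\<close>, Pascal's rule turns the sum into \<open>Suc N choose Suc d\<close> with
  remainder 0. Starting at \<open>N = d\<close> secures \<open>d <= N\<close>, as the carry rule
  \<open>macaulay_lower_split_le\<close> requires.\<close>

lemma macaulay_split_exists:
  obtains N r where "d \<le> N" "r < N choose d" "c = (N choose Suc d) + r"
proof -
  have "\<exists>N r. d \<le> N \<and> r < N choose d \<and> c = (N choose Suc d) + r"
  proof (induction c)
    case 0
    show ?case by (intro exI[of _ d] exI[of _ 0]) simp
  next
    case (Suc c)
    then obtain N r where Nr: "d \<le> N" "r < N choose d" "c = (N choose Suc d) + r" by blast
    show ?case
    proof (cases "Suc r < N choose d")
      case True
      with Nr show ?thesis by (intro exI[of _ N] exI[of _ "Suc r"]) simp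
    next
      case False
      with Nr have "Suc c = Suc N choose Suc d" by simp
      moreover have "0 < Suc N choose d" using Nr by simp
      ultimately show ?thesis using Nr(1) by (intro exI[of _ "Suc N"] exI[of _ 0]) simp
    qed
  qed
  then show ?thesis using that by blast
qed

lemma macaulay_lower_0_right [simp]: "macaulay_lower d 0 = 0"
proof (induction d)
  case (Suc d)
  show ?case using macaulay_lower_split[of 0 d d] Suc by (simp add: binomial_eq_0)
qed simp

lemma macaulay_lower_1: "macaulay_lower (Suc 0) c = c - 1"
  using macaulay_lower_split[of 0 c 0] by simp

lemma macaulay_lower_one:
  assumes "d > 0"
  shows "macaulay_lower d (Suc 0) = 0"
  using assms macaulay_lower_split[of 0 d "d - 1"] by (cases d) simp_all

lemma macaulay_lower_binomial:
  assumes "d > 0" "d \<le> N"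
  shows "macaulay_lower d (N choose d) = (N - 1) choose d"
  using assms macaulay_lower_split[of 0 N "d - 1"] by (cases d) simp_all

text \<open>The boundary case \<open>r = N choose d\<close> is a carry, consistent by Pascal's rule.\<close>

lemma macaulay_lower_split_le:
  assumes "d > 0" "d \<le> N" "r \<le> N choose d"
  shows "macaulay_lower (Suc d) ((N choose Suc d) + r) = ((N - 1) choose Suc d) + macaulay_lower d r"
proof (cases "r = N choose d")
  case True
  then have "(N choose Suc d) + r = Suc N choose Suc d" by simp
  then have "macaulay_lower (Suc d) ((N choose Suc d) + r) = N choose Suc d"
    using macaulay_lower_binomial[of "Suc d" "Suc N"] assms by (simp only: diff_Suc_1)
  also have "\<dots> = ((N - 1) choose Suc d) + ((N - 1) choose d)"
    using assms by (cases N) simp_all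
  finally show ?thesis using macaulay_lower_binomial[of d N] assms True by simp
qed (use assms macaulay_lower_split in simp)

section \<open>Growth bounds and the numerical criterion\<close>

text \<open>\<open>c\<close> and \<open>Suc c\<close> can share the top entry \<open>N\<close>, with
  remainders \<open>r\<close> and \<open>Suc r\<close>; the latter may equal
  \<open>N choose d\<close>, which the carry rule allows. So a step of 0 or 1 is inherited from the
  remainders, starting from degree 1, where the value is \<open>c - 1\<close>.\<close>

lemma macaulay_lower_Suc:
  "macaulay_lower d c \<le> macaulay_lower d (Suc c) \<and> macaulay_lower d (Suc c) \<le> Suc (macaulay_lower d c)"
proof (induction d arbitrary: c)
  case (Suc d)
  show ?case
  proof (cases "d = 0")
    case True
    then show ?thesis by (auto simp: macaulay_lower_1)
  next
    case False
    obtain N r where Nr: "d \<le> N" "r < N choose d" "c = (N choose Suc d) + r"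
      by (rule macaulay_split_exists)
    show ?thesis
      using macaulay_lower_split_le[of d N r] macaulay_lower_split_le[of d N "Suc r"] Nr False
        Suc.IH[of r] by simp
  qed
qed simp

lemma macaulay_lower_mono: "a \<le> b \<Longrightarrow> macaulay_lower d a \<le> macaulay_lower d b"
  by (rule lift_Suc_mono_le[of "macaulay_lower d"]) (use macaulay_lower_Suc in auto)

lemma macaulay_lower_diff_le:
  "a \<le> b \<Longrightarrow> macaulay_lower d b \<le> macaulay_lower d a + (b - a)"
proof (induction b rule: dec_induct)
  case (step b)
  then show ?case using macaulay_lower_Suc[of d b] by linarith
qed simp

lemma macaulay_lower_less:
  assumes "0 < d" "0 < c"
  shows "macaulay_lower d c < c"
  using macaulay_lower_diff_le[of "Suc 0" c d] macaulay_lower_one[of d] assms by simp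

text \<open>By monotonicity only \<open>r = (N choose d) - 1\<close> matters. Its top coefficient is
  \<open>(N - 1) choose d\<close> and its remainder is one below
  \<open>(N - 1) choose (d - 1)\<close>, so induction and Pascal's rule apply. For
  \<open>N = d\<close> the bound is false: \<open>r = 0\<close> is allowed and the right side is
  0.\<close>

lemma macaulay_lower_less_binomial:
  assumes "0 < d" "d < N" "r < N choose d"
  shows "macaulay_lower d r < (N - 1) choose d"
  using assms
proof (induction d arbitrary: N r)
  case (Suc d)
  show ?case
  proof (cases "d = 0")
    case True
    then show ?thesis using Suc.prems by (auto simp: macaulay_lower_1)
  next
    case False
    obtain M where M: "N = Suc M" "M > d" using Suc.prems by (cases N) auto
    have pos: "0 < M choose d" using M by simp
    have "macaulay_lower (Suc d) r \<le> macaulay_lower (Suc d) ((M choose Suc d) + ((M choose d) - 1))"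
      using Suc.prems M pos by (intro macaulay_lower_mono) simp
    also have "\<dots> = ((M - 1) choose Suc d) + macaulay_lower d ((M choose d) - 1)"
      using pos by (intro macaulay_lower_split) simp
    also have "macaulay_lower d ((M choose d) - 1) < (M - 1) choose d"
      using False M pos by (intro Suc.IH) auto
    also have "((M - 1) choose Suc d) + ((M - 1) choose d) = M choose Suc d"
      using M by (cases M) simp_all
    finally show ?thesis using M by simp
  qed
qed simp

text \<open>With \<open>x = macaulay_lower d c\<close>, this says that \<open>m = Suc x\<close>
  violates \<open>m <= macaulay_lower d m + macaulay_lower (d - 1) (c - m)\<close>, the inequality
  supplied by the exact sequence. Splitting along the top coefficient of \<open>c\<close> and using
  Pascal's rule leaves the same claim for the remainder, one degree lower.\<close>

lemma macaulay_lower_Suc_lower: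
  assumes "0 < d" "0 < c"
  shows "macaulay_lower d (Suc (macaulay_lower d c))
           + macaulay_lower (d - 1) (c - Suc (macaulay_lower d c)) \<le> macaulay_lower d c"
  using assms
proof (induction d arbitrary: c)
  case (Suc d)
  show ?case
  proof (cases "d = 0")
    case True
    then show ?thesis using Suc.prems by (simp add: macaulay_lower_1)
  next
    case False
    then obtain e where e: "d = Suc e" by (cases d) auto
    obtain N r where Nr: "d \<le> N" "r < N choose d" "c = (N choose Suc d) + r"
      by (rule macaulay_split_exists)
    have "N > d"
    proof (rule ccontr)
      assume "\<not> N > d"
      then have "N = d" using Nr by simp
      then show False using Nr Suc.prems by simp
    qed
    then obtain M where M: "N = Suc M" "d \<le> M" by (cases N) auto
    obtain M' where M': "M = Suc M'" using M e by (cases M) auto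
    define y where "y = macaulay_lower d r"
    have lc: "macaulay_lower (Suc d) c = (M choose Suc d) + y"
      using macaulay_lower_split[OF Nr(2)] Nr(3) M by (simp add: y_def)
    \<comment> \<open>Strictness makes \<open>Suc y\<close> an admissible remainder under the top
      entry \<open>M\<close>, the carry included.\<close>
    have y: "Suc y \<le> M choose d"
      using macaulay_lower_less_binomial[of d N r] False \<open>N > d\<close> Nr M unfolding y_def by simp
    have l1: "macaulay_lower (Suc d) (Suc ((M choose Suc d) + y))
        = (M' choose Suc d) + macaulay_lower d (Suc y)"
      using macaulay_lower_split_le[of d M "Suc y"] False M y M' by simp
    have pascal: "M choose Suc d = (M' choose Suc d) + (M' choose d)" using M' by simp
    \<comment> \<open>The induction hypothesis needs a positive remainder. For \<open>r = 0\<close>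
      the argument of the second summand is \<open>(M choose d) - 1\<close>, and monotonicity
      suffices.\<close>
    show ?thesis
    proof (cases "r = 0")
      case True
      then have "y = 0" by (simp add: y_def)
      have "macaulay_lower d ((M choose d) - 1) \<le> macaulay_lower d (M choose d)"
        by (rule macaulay_lower_mono) simp
      also have "\<dots> = M' choose d" using macaulay_lower_binomial[of d M] False M M' by simp
      finally show ?thesis
        using lc l1 pascal \<open>y = 0\<close> macaulay_lower_one[of d] False Nr True M by simp
    next
      case rpos: False
      have "y < r" unfolding y_def using macaulay_lower_less[of d r] rpos False by simp
      \<comment> \<open>From \<open>r\<close> to \<open>N choose d\<close> the lowered value grows
        from \<open>y\<close> to \<open>M choose d\<close>, by at most the distance. Since
        \<open>N choose d = (M choose d) + (M choose e)\<close>, this gives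
        \<open>r - y <= M choose e\<close>, so \<open>r - Suc y\<close> is a legal
        remainder.\<close>
      have "M choose d \<le> y + ((N choose d) - r)"
        using macaulay_lower_diff_le[of r "N choose d" d] macaulay_lower_binomial[of d N]
          False Nr M unfolding y_def by simp
      then have rest: "r - Suc y < M choose e"
        using \<open>y < r\<close> M e Nr(2) by simp
      have "macaulay_lower d ((M choose d) + (r - Suc y)) = (M' choose d) + macaulay_lower e (r - Suc y)"
        using macaulay_lower_split[of "r - Suc y" M e] rest e M' by simp
      moreover have "c - Suc ((M choose Suc d) + y) = (M choose d) + (r - Suc y)"
        using Nr M \<open>y < r\<close> by simp
      moreover have "macaulay_lower d (Suc y) + macaulay_lower e (r - Suc y) \<le> y"
        using Suc.IH[of r] rpos False e unfolding y_def by simp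
      ultimately show ?thesis using lc l1 pascal by simp
    qed
  qed
qed simp

text \<open>Let \<open>x = macaulay_lower d c\<close>. If \<open>m\<close> exceeded
  \<open>x\<close>, passing from \<open>Suc x\<close> to \<open>m\<close> would raise the first
  summand by at most \<open>m - Suc x\<close> and not raise the second. By
  \<open>macaulay_lower_Suc_lower\<close> the sum would then be at most
  \<open>m - 1\<close>.\<close>

lemma le_macaulay_lower:
  assumes "0 < d" "m \<le> c" "m \<le> macaulay_lower d m + macaulay_lower (d - 1) (c - m)"
  shows "m \<le> macaulay_lower d c"
proof (rule ccontr)
  define x where "x = macaulay_lower d c"
  assume "\<not> m \<le> macaulay_lower d c"
  then have m: "Suc x \<le> m" by (simp add: x_def)
  have "macaulay_lower d m \<le> macaulay_lower d (Suc x) + (m - Suc x)"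
    using macaulay_lower_diff_le[OF m] .
  moreover have "macaulay_lower (d - 1) (c - m) \<le> macaulay_lower (d - 1) (c - Suc x)"
    using m by (intro macaulay_lower_mono) simp
  moreover have "macaulay_lower d (Suc x) + macaulay_lower (d - 1) (c - Suc x) \<le> x"
    unfolding x_def using assms m by (intro macaulay_lower_Suc_lower) auto
  ultimately show False using assms(3) m by simp
qed

section \<open>Dimensions of subspaces of finite dimension\<close>

text \<open>A locale of its own: facts added to \<open>vector_space\<close> would be exported, without a qualifier, by its
  interpretation \<open>real_vector\<close> and shadow the generic ones.\<close>

locale vec_space = vector_space scale
  for scale :: "'a::field \<Rightarrow> 'b::ab_group_add \<Rightarrow> 'b"
begin

text \<open>The space of all polynomials has infinite dimension, and \<open>dim\<close> is 0 for a
  space with an infinite basis, so dimension counts carry this hypothesis.\<close>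

definition finite_dim :: "'b set \<Rightarrow> bool" where
  "finite_dim U \<longleftrightarrow> (\<exists>B. finite B \<and> U \<subseteq> span B)"

lemma finite_dim_subset: "finite_dim U \<Longrightarrow> W \<subseteq> U \<Longrightarrow> finite_dim W"
  unfolding finite_dim_def by blast

lemma span_insert_span: "span (insert v (span B)) = span (insert v B)"
proof
  have "span B \<subseteq> span (insert v B)" by (intro span_mono) auto
  then show "span (insert v (span B)) \<subseteq> span (insert v B)"
    by (intro span_minimal) (auto intro: span_base)
  show "span (insert v B) \<subseteq> span (insert v (span B))"
    by (intro span_mono) (auto intro: span_base)
qed

lemma finite_dim_span_insert:
  assumes "finite_dim U"
  shows "finite_dim (span (insert v U))"
proof -
  obtain B where B: "finite B" "U \<subseteq> span B" using assms unfolding finite_dim_def by blast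
  then have "span (insert v U) \<subseteq> span (insert v (span B))" by (intro span_mono) auto
  then show ?thesis using B(1) unfolding span_insert_span finite_dim_def by blast
qed

lemma dim_span_insert:
  assumes "subspace U" "finite_dim U" "v \<notin> U"
  shows "dim (span (insert v U)) = Suc (dim U)"
proof -
  obtain B where B: "B \<subseteq> U" "independent B" "U \<subseteq> span B" "card B = dim U"
    using basis_exists by blast
  obtain C where "finite C" "U \<subseteq> span C" using assms(2) unfolding finite_dim_def by blast
  then have "finite B" using independent_span_bound[of C B] B by auto
  have sB: "span B = U" using B assms(1) by (simp add: span_minimal subset_antisym)
  then have "v \<notin> span B" using assms(3) by simp
  from independent_insertI[OF this B(2)] have ind: "independent (insert v B)" .
  have "v \<notin> B" using \<open>v \<notin> span B\<close> span_base by blast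
  have "span (insert v U) = span (insert v B)"
    using span_insert_span[of v B] sB by simp
  then have "dim (span (insert v U)) = card (insert v B)"
    using dim_span_eq_card_independent[OF ind] by (simp only:)
  then show ?thesis using \<open>finite B\<close> \<open>v \<notin> B\<close> B(4) by simp
qed

lemma mem_span_insert_subspace:
  assumes "subspace U"
  shows "x \<in> span (insert v U) \<longleftrightarrow> (\<exists>k. \<exists>u\<in>U. x = scale k v + u)"
proof -
  have "x \<in> span (insert v U) \<longleftrightarrow> (\<exists>k. x - scale k v \<in> U)"
    unfolding span_breakdown_eq span_eq_iff[THEN iffD2, OF assms] ..
  also have "\<dots> \<longleftrightarrow> (\<exists>k. \<exists>u\<in>U. x = scale k v + u)"
    by (metis add_diff_cancel_left' diff_add_cancel add.commute)
  finally show ?thesis .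
qed

text \<open>Lets a dimension formula be proved by adjoining one vector at a time. The vectors come
  from a finite basis of \<open>U\<close>; those already in the current span are skipped.\<close>

lemma subspace_chain_induct [consumes 4, case_names base step]:
  assumes "subspace W" "subspace U" "W \<subseteq> U" "finite_dim U"
    and base: "P W"
    and step: "\<And>U' v. subspace U' \<Longrightarrow> W \<subseteq> U' \<Longrightarrow> U' \<subseteq> U \<Longrightarrow> v \<in> U \<Longrightarrow> v \<notin> U' \<Longrightarrow> P U' \<Longrightarrow>
               P (span (insert v U'))"
  shows "P U"
proof -
  obtain B where B: "B \<subseteq> U" "independent B" "U \<subseteq> span B" using basis_exists[of U] .
  obtain C where "finite C" "U \<subseteq> span C" using assms(4) unfolding finite_dim_def by blast
  then have "finite B" using independent_span_bound[of C B] B by auto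
  have "P (span (A \<union> W))" if "finite A" "A \<subseteq> U" for A
    using that
  proof (induction A rule: finite_induct)
    case empty
    show ?case unfolding Un_empty_left span_eq_iff[THEN iffD2, OF assms(1)] by (rule base)
  next
    case (insert a A)
    have eq: "span (insert a A \<union> W) = span (insert a (span (A \<union> W)))"
      by (simp add: span_insert_span)
    show ?case
    proof (cases "a \<in> span (A \<union> W)")
      case True
      then have "span (insert a (span (A \<union> W))) = span (A \<union> W)"
        using span_redundant[of a "span (A \<union> W)"] by (simp only: span_span)
      then show ?thesis using insert unfolding eq by simp
    next
      case False
      show ?thesis unfolding eq
      proof (rule step)
        show "W \<subseteq> span (A \<union> W)" using span_superset[of "A \<union> W"] by auto
        show "span (A \<union> W) \<subseteq> U" using insert assms by (intro span_minimal) auto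
      qed (use insert False in auto)
    qed
  qed
  from this[OF \<open>finite B\<close> B(1)] have "P (span (B \<union> W))" .
  moreover have "span (B \<union> W) = U"
  proof
    show "span (B \<union> W) \<subseteq> U" using B assms by (intro span_minimal) auto
    have "span B \<subseteq> span (B \<union> W)" by (intro span_mono) auto
    then show "U \<subseteq> span (B \<union> W)" using B by auto
  qed
  ultimately show ?thesis by simp
qed

section \<open>Sums of subspaces and relative rank-nullity\<close>

lemma subspace_set_plus: "subspace U \<Longrightarrow> subspace W \<Longrightarrow> subspace (U + W)"
  using subspace_sums[of U W] by (simp add: set_plus_def Bex_def conj_ac cong: conj_cong)

lemma subset_set_plus_left: "subspace W \<Longrightarrow> U \<subseteq> U + W"
  using set_zero_plus2[of W U] subspace_0[of W] by (simp add: add.commute)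

lemma finite_dim_set_plus:
  assumes "finite_dim U" "finite_dim W"
  shows "finite_dim (U + W)"
proof -
  obtain B C where "finite B" "finite C" "U \<subseteq> span B" "W \<subseteq> span C"
    using assms unfolding finite_dim_def by blast
  moreover have "span B \<subseteq> span (B \<union> C)" "span C \<subseteq> span (B \<union> C)" by (simp_all add: span_mono)
  ultimately have "U + W \<subseteq> span (B \<union> C)"
    by (auto simp: set_plus_def intro!: span_add)
  then show ?thesis using \<open>finite B\<close> \<open>finite C\<close> unfolding finite_dim_def by blast
qed

lemma dim_subspace_mono:
  assumes "subspace W" "subspace U" "W \<subseteq> U" "finite_dim U"
  shows "dim W \<le> dim U"
  using assms
proof (induction rule: subspace_chain_induct)
  case (step U' v)
  then show ?case using dim_span_insert[of U' v] finite_dim_subset[OF assms(4)] by simp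
qed simp

text \<open>Rank-nullity for the map from \<open>U\<close> to the quotient by \<open>W\<close>,
  without forming the quotient. Adjoining a new \<open>v\<close> to \<open>U\<close> raises exactly
  one of the two dimensions on the left by 1, according to whether \<open>f v\<close> already lies
  in the sum.\<close>

lemma dim_plus_image:
  assumes "Vector_Spaces.linear scale scale f" "subspace U" "finite_dim U" "subspace W" "finite_dim W"
  shows "dim (W + f ` U) + dim {u \<in> U. f u \<in> W} = dim W + dim U"
proof -
  interpret f: Vector_Spaces.linear scale scale f by fact
  let ?N = "\<lambda>U. {u \<in> U. f u \<in> W}"
  have sN: "subspace (?N U')" if "subspace U'" for U'
    using that assms(4)
    by (auto simp: subspace_def f.add f.scale f.zero)
  have sf: "subspace (f ` U')" if "subspace U'" for U'
    using that by (rule f.subspace_image)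
  have "{0} \<subseteq> U" using assms(2) by (simp add: subspace_0)
  from subspace_single_0 assms(2) this assms(3) show ?thesis
  proof (induction rule: subspace_chain_induct)
    case base
    have "?N {0} = {0}" using assms(4) by (auto simp: f.zero subspace_0)
    moreover have "W + f ` {0} = W" by (simp add: f.zero set_plus_def)
    ultimately show ?case by simp
  next
    case (step U' v)
    let ?U = "span (insert v U')"
    have fdU': "finite_dim U'" using step finite_dim_subset[OF assms(3)] by blast
    have sU: "subspace ?U" by simp
    have fdU: "finite_dim ?U" by (rule finite_dim_span_insert[OF fdU'])
    have dU: "dim ?U = Suc (dim U')" using dim_span_insert step fdU' by blast
    have fdfU': "finite_dim (f ` U')"
      using fdU' unfolding finite_dim_def using f.span_image by (metis finite_imageI image_mono)
    have sWf: "subspace (W + f ` U')" using assms(4) sf step(1) by (intro subspace_set_plus)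
    have fdWf: "finite_dim (W + f ` U')" using assms(5) fdfU' by (rule finite_dim_set_plus)
    have U'U: "U' \<subseteq> ?U" using span_superset[of "insert v U'"] by auto
    have vU: "v \<in> ?U" by (simp add: span_base)
    show ?case
    proof (cases "f v \<in> W + f ` U'")
      case True
      then obtain w u where wu: "w \<in> W" "u \<in> U'" "f v = w + f u" by (auto simp: set_plus_def)
      \<comment> \<open>Correcting \<open>v\<close> by an element of \<open>U'\<close> gives the
        same extension, but now \<open>f z\<close> lies in \<open>W\<close>: the kernel gains
        \<open>z\<close> and the sum stays the same.\<close>
      define z where "z = v - u"
      have fz: "f z = w" using wu(3) by (simp add: z_def f.diff)
      have zU: "z \<in> ?U" unfolding z_def using wu(2) U'U vU by (intro span_diff) auto
      have zU': "z \<notin> U'"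
        using subspace_add[OF step(1), of z u] wu(2) step(5) by (auto simp: z_def)
      note z = fz zU zU'
      have Uz: "?U = span (insert z U')"
      proof (rule subset_antisym; rule span_minimal)
        show "insert v U' \<subseteq> span (insert z U')"
          using wu(2) span_add[OF span_base[of z] span_base[of u], of "insert z U'"]
          by (auto simp: z_def intro!: span_base)
        show "insert z U' \<subseteq> ?U" using z U'U by auto
      qed simp_all
      have "W + f ` ?U = W + f ` U'"
      proof
        show "W + f ` U' \<subseteq> W + f ` ?U" using U'U by (intro set_plus_mono2) auto
        have "f ` ?U = span (insert (f v) (f ` U'))" by (simp add: f.span_image[symmetric])
        also have "\<dots> \<subseteq> W + f ` U'"
          using True sWf subset_set_plus_left[OF assms(4), of "f ` U'"]
          by (intro span_minimal) (auto simp: add.commute)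
        finally show "W + f ` ?U \<subseteq> W + f ` U'"
          using sWf subset_set_plus_left[OF sf[OF step(1)], of W]
          by (auto simp: set_plus_def[of W "f ` ?U"] intro!: subspace_add[OF sWf])
      qed
      moreover have "?N ?U = span (insert z (?N U'))"
      proof (rule Set.set_eqI)
        fix x
        have "f u \<in> W \<longleftrightarrow> f (scale k z + u) \<in> W" for k u
          using subspace_add[OF assms(4), of "f u" "scale k w"] subspace_scale[OF assms(4) wu(1), of k]
            subspace_diff[OF assms(4), of "scale k w + f u" "scale k w"]
          by (auto simp: f.add f.scale z(1) add.commute)
        then show "x \<in> ?N ?U \<longleftrightarrow> x \<in> span (insert z (?N U'))"
          unfolding Uz using mem_span_insert_subspace[OF sN[OF step(1)], of x z]
            mem_span_insert_subspace[OF step(1), of x z] by auto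
      qed
      moreover have "dim (span (insert z (?N U'))) = Suc (dim (?N U'))"
        using sN[OF step(1)] finite_dim_subset[OF fdU'] z by (intro dim_span_insert) auto
      ultimately show ?thesis using step.IH dU by simp
    next
      case False
      \<comment> \<open>The kernel cannot grow here: a nonzero coefficient of \<open>v\<close> could
        be inverted, which would put \<open>f v\<close> into the sum.\<close>
      have "?N ?U = ?N U'"
      proof
        show "?N U' \<subseteq> ?N ?U" using U'U by auto
        show "?N ?U \<subseteq> ?N U'"
        proof safe
          fix x assume x: "x \<in> ?U" "f x \<in> W"
          then obtain k u where ku: "u \<in> U'" "x = scale k v + u"
            using mem_span_insert_subspace[OF step(1)] by blast
          have "k = 0"
          proof (rule ccontr)
            assume "k \<noteq> 0"
            have "scale k (f v) = f x + f (- u)"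
              using ku by (simp add: f.add f.scale f.neg)
            then have "scale k (f v) \<in> W + f ` U'"
              using set_plus_intro[OF x(2) imageI[OF subspace_neg[OF step(1) ku(1)]]] by simp
            then have "scale (inverse k) (scale k (f v)) \<in> W + f ` U'"
              by (rule subspace_scale[OF sWf])
            then show False using \<open>k \<noteq> 0\<close> False by simp
          qed
          then show "x \<in> U'" using ku by simp
        qed
      qed
      moreover have "W + f ` ?U = span (insert (f v) (W + f ` U'))"
      proof (rule Set.set_eqI)
        fix x
        have img: "f ` ?U = {scale k (f v) + f u |k u. u \<in> U'}"
        proof (rule Set.set_eqI)
          fix y
          have "y \<in> f ` ?U \<longleftrightarrow> (\<exists>t. t \<in> ?U \<and> y = f t)" by blast
          also have "\<dots> \<longleftrightarrow> (\<exists>k. \<exists>u\<in>U'. y = f (scale k v + u))"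
            unfolding mem_span_insert_subspace[OF step(1)] by blast
          finally show "y \<in> f ` ?U \<longleftrightarrow> y \<in> {scale k (f v) + f u |k u. u \<in> U'}"
            unfolding f.add f.scale by blast
        qed
        have "x \<in> W + f ` ?U \<longleftrightarrow> (\<exists>k. \<exists>w\<in>W. \<exists>u\<in>U'. x = w + (scale k (f v) + f u))"
          by (auto simp: img set_plus_def)
        also have "\<dots> \<longleftrightarrow> (\<exists>k. \<exists>y\<in>W + f ` U'. x = scale k (f v) + y)"
        proof (intro iffI; elim exE bexE)
          fix k w u assume "w \<in> W" "u \<in> U'" "x = w + (scale k (f v) + f u)"
          then show "\<exists>k. \<exists>y\<in>W + f ` U'. x = scale k (f v) + y"
            by (intro exI[of _ k] bexI[of _ "w + f u"]) (auto simp: add.left_commute)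
        next
          fix k y assume "y \<in> W + f ` U'" and x: "x = scale k (f v) + y"
          then obtain w u where "w \<in> W" "u \<in> U'" "y = w + f u" by (auto simp: set_plus_def)
          with x show "\<exists>k. \<exists>w\<in>W. \<exists>u\<in>U'. x = w + (scale k (f v) + f u)"
            by (intro exI[of _ k] bexI[of _ w] bexI[of _ u]) (auto simp: add.left_commute)
        qed
        finally show "x \<in> W + f ` ?U \<longleftrightarrow> x \<in> span (insert (f v) (W + f ` U'))"
          unfolding mem_span_insert_subspace[OF sWf] .
      qed
      moreover have "dim (span (insert (f v) (W + f ` U'))) = Suc (dim (W + f ` U'))"
        using sWf fdWf False by (rule dim_span_insert)
      ultimately show ?thesis using step.IH dU by simp
    qed
  qed
qed

end

section \<open>Hyperplane restriction for spaces of forms\<close>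

text \<open>Scaling is multiplication by a constant polynomial, so that it agrees with the scalars
  \<open>range (Poly_Mapping.single 0)\<close> used on the ring side.\<close>

definition mscale :: "'k::field \<Rightarrow> 'k mpoly \<Rightarrow> 'k mpoly" where
  "mscale c p = Poly_Mapping.single 0 c * p"

interpretation mp: vec_space mscale
proof unfold_locales
  fix a b :: "'k::field" and x y :: "'k mpoly"
  show "mscale a (x + y) = mscale a x + mscale a y" by (simp add: mscale_def distrib_left)
  show "mscale (a + b) x = mscale a x + mscale b x" by (simp add: mscale_def single_add distrib_right)
  show "mscale a (mscale b x) = mscale (a * b) x"
    by (simp add: mscale_def mult.assoc[symmetric] mult_single)
  show "mscale 1 x = x" by (simp add: mscale_def)
qed

lemma mult_mscale: "p * mscale c q = mscale c (p * q)"
  by (simp add: mscale_def mult_ac)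

lemma linear_mult: "Vector_Spaces.linear mscale mscale ((*) p)"
  by unfold_locales (simp_all add: distrib_left mult_mscale)

lemma keys_mscale: "Poly_Mapping.keys (mscale c p) \<subseteq> Poly_Mapping.keys p"
  using keys_mult[of "Poly_Mapping.single 0 c" p] by (auto simp: mscale_def split: if_splits)

lemma poly_mapping_sum_single: "p = (\<Sum>m \<in> Poly_Mapping.keys p. Poly_Mapping.single m (Poly_Mapping.lookup p m))"
proof (rule poly_mapping_eqI)
  fix k
  show "Poly_Mapping.lookup p k =
      Poly_Mapping.lookup (\<Sum>m \<in> Poly_Mapping.keys p. Poly_Mapping.single m (Poly_Mapping.lookup p m)) k"
    by (cases "k \<in> Poly_Mapping.keys p")
      (auto simp: lookup_sum lookup_single when_def in_keys_iff)
qed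

lemma monom_degree_superset:
  assumes "finite A" "Poly_Mapping.keys m \<subseteq> A"
  shows "monom_degree m = (\<Sum>i \<in> A. Poly_Mapping.lookup m i)"
  unfolding monom_degree_def using assms by (intro sum.mono_neutral_left) (auto simp: in_keys_iff)

lemma monom_degree_add: "monom_degree (a + b) = monom_degree a + monom_degree b"
proof -
  let ?A = "Poly_Mapping.keys a \<union> Poly_Mapping.keys b"
  have "Poly_Mapping.keys (a + b) \<subseteq> ?A" by (rule Poly_Mapping.keys_add)
  then show ?thesis
    using monom_degree_superset[of ?A a] monom_degree_superset[of ?A b]
      monom_degree_superset[of ?A "a + b"] by (simp add: lookup_add sum.distrib)
qed

lemma monom_degree_single [simp]: "monom_degree (Poly_Mapping.single i k) = k"
  by (simp add: monom_degree_def)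

definition monoms :: "nat \<Rightarrow> nat \<Rightarrow> (nat \<Rightarrow>\<^sub>0 nat) set" where
  "monoms n d = {m. Poly_Mapping.keys m \<subseteq> {..<n} \<and> monom_degree m = d}"

lemma forms_iff: "p \<in> forms n d \<longleftrightarrow> Poly_Mapping.keys p \<subseteq> monoms n d"
  by (auto simp: forms_def mpoly_ring_def monoms_def)

text \<open>Every exponent is at most the degree, so a monomial is determined by a function from
  \<open>{..<n}\<close> to \<open>{..d}\<close>.\<close>

lemma finite_monoms: "finite (monoms n d)"
proof -
  have "monoms n d \<subseteq> (\<lambda>f. \<Sum>i<n. Poly_Mapping.single i (f i)) ` ({..<n} \<rightarrow>\<^sub>E {..d})"
  proof
    fix m assume m: "m \<in> monoms n d"
    have "monom_degree m = (\<Sum>i<n. Poly_Mapping.lookup m i)"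
      using m by (intro monom_degree_superset) (auto simp: monoms_def)
    then have "Poly_Mapping.lookup m i \<le> d" if "i < n" for i
      using member_le_sum[of i "{..<n}" "Poly_Mapping.lookup m"] m that by (simp add: monoms_def)
    then have "restrict (Poly_Mapping.lookup m) {..<n} \<in> {..<n} \<rightarrow>\<^sub>E {..d}" by auto
    moreover have "m = (\<Sum>i<n. Poly_Mapping.single i (restrict (Poly_Mapping.lookup m) {..<n} i))"
    proof -
      have "m = (\<Sum>i \<in> Poly_Mapping.keys m. Poly_Mapping.single i (Poly_Mapping.lookup m i))"
        by (rule poly_mapping_sum_single)
      also have "\<dots> = (\<Sum>i<n. Poly_Mapping.single i (Poly_Mapping.lookup m i))"
        using m by (intro sum.mono_neutral_left) (auto simp: monoms_def in_keys_iff)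
      finally show ?thesis by simp
    qed
    ultimately show "m \<in> (\<lambda>f. \<Sum>i<n. Poly_Mapping.single i (f i)) ` ({..<n} \<rightarrow>\<^sub>E {..d})"
      by blast
  qed
  then show ?thesis by (rule finite_subset) (intro finite_imageI finite_PiE; simp)
qed

lemma mem_subspace_monoms:
  assumes "mp.subspace W" "\<And>m. m \<in> Poly_Mapping.keys p \<Longrightarrow> Poly_Mapping.single m 1 \<in> W"
  shows "p \<in> W"
proof -
  have "Poly_Mapping.single m c = mscale c (Poly_Mapping.single m 1)" for m c
    by (simp add: mscale_def mult_single)
  then have "Poly_Mapping.single m (Poly_Mapping.lookup p m) \<in> W" if "m \<in> Poly_Mapping.keys p" for m
    using mp.subspace_scale[OF assms(1) assms(2)[OF that]] by metis
  then have "(\<Sum>m \<in> Poly_Mapping.keys p. Poly_Mapping.single m (Poly_Mapping.lookup p m)) \<in> W"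
    by (rule mp.subspace_sum[OF assms(1)])
  then show ?thesis using poly_mapping_sum_single[of p] by simp
qed

lemma subspace_forms: "mp.subspace (forms n d)"
proof (rule mp.subspaceI)
  fix x y :: "'a mpoly" and c
  assume "x \<in> forms n d" "y \<in> forms n d"
  then show "x + y \<in> forms n d"
    using Poly_Mapping.keys_add[of x y] by (auto simp: forms_iff)
  show "mscale c x \<in> forms n d"
    using \<open>x \<in> forms n d\<close> keys_mscale[of c x] by (auto simp: forms_iff)
qed (simp add: forms_iff)

lemmas forms_0 [simp] = mp.subspace_0[OF subspace_forms]
  and forms_add = mp.subspace_add[OF subspace_forms]
  and forms_mscale = mp.subspace_scale[OF subspace_forms]

lemma finite_dim_forms: "mp.finite_dim (forms n d)"
proof -
  let ?B = "(\<lambda>m. Poly_Mapping.single m 1) ` monoms n d"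
  have "p \<in> mp.span ?B" if "p \<in> forms n d" for p :: "'a mpoly"
    by (rule mem_subspace_monoms[OF mp.subspace_span]) (use that in \<open>auto simp: forms_iff intro!: mp.span_base\<close>)
  then show ?thesis unfolding mp.finite_dim_def using finite_monoms by blast
qed

lemma forms_mult:
  assumes "p \<in> forms n i" "q \<in> forms n j"
  shows "p * q \<in> forms n (i + j)"
  unfolding forms_iff
proof
  fix m assume "m \<in> Poly_Mapping.keys (p * q)"
  then obtain a b where "m = a + b" "a \<in> Poly_Mapping.keys p" "b \<in> Poly_Mapping.keys q"
    using keys_mult[of p q] by auto
  then show "m \<in> monoms n (i + j)"
    using assms Poly_Mapping.keys_add[of a b] by (fastforce simp: forms_iff monoms_def monom_degree_add)
qed

text \<open>The standard grading enters here: a monomial of positive degree is a variable times a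
  monomial of degree one lower.\<close>

lemma forms_Suc_subset:
  assumes "mp.subspace W" "\<And>v q. v \<in> forms n 1 \<Longrightarrow> q \<in> forms n d \<Longrightarrow> v * q \<in> W"
  shows "forms n (Suc d) \<subseteq> W"
proof
  fix p :: "'a mpoly" assume p: "p \<in> forms n (Suc d)"
  show "p \<in> W"
  proof (rule mem_subspace_monoms[OF assms(1)])
    fix m assume "m \<in> Poly_Mapping.keys p"
    then have m: "Poly_Mapping.keys m \<subseteq> {..<n}" "monom_degree m = Suc d"
      using p by (auto simp: forms_iff monoms_def)
    then obtain i where i: "i \<in> Poly_Mapping.keys m" unfolding monom_degree_def by fastforce
    define m' where "m' = m - Poly_Mapping.single i 1"
    have mm': "m = Poly_Mapping.single i 1 + m'"
    proof (rule poly_mapping_eqI)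
      fix j show "Poly_Mapping.lookup m j = Poly_Mapping.lookup (Poly_Mapping.single i 1 + m') j"
        using i by (auto simp: m'_def lookup_add lookup_minus lookup_single when_def in_keys_iff)
    qed
    have "Poly_Mapping.keys m' \<subseteq> Poly_Mapping.keys m"
      by (auto simp: m'_def in_keys_iff lookup_minus)
    then have m': "m' \<in> monoms n d"
      using m monom_degree_add[of "Poly_Mapping.single i 1" m'] mm' by (auto simp: monoms_def)
    have "Poly_Mapping.single (Poly_Mapping.single i 1) 1 * Poly_Mapping.single m' 1 \<in> W"
      using i m m' by (intro assms(2)) (auto simp: forms_iff monoms_def)
    then show "Poly_Mapping.single m 1 \<in> W" by (simp add: mult_single mm')
  qed
qed

section \<open>Codimension and the colon exact sequence\<close>

text \<open>Degree parts of quotient algebras are represented by their spaces of relations inside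
  \<open>forms n d\<close>; this is their dimension. For subspaces of \<open>forms n d\<close> the
  subtraction does not truncate.\<close>

definition codim :: "nat \<Rightarrow> nat \<Rightarrow> 'k::field mpoly set \<Rightarrow> nat" where
  "codim n d W = mp.dim (forms n d :: 'k mpoly set) - mp.dim W"

lemma codim_antimono:
  assumes "mp.subspace W" "mp.subspace W'" "W \<subseteq> W'" "W' \<subseteq> forms n d"
  shows "codim n d W' \<le> codim n d W"
  unfolding codim_def
  using mp.dim_subspace_mono[OF assms(1-3)] mp.finite_dim_subset[OF finite_dim_forms assms(4)] by simp

lemma codim_insert_less:
  fixes V :: "'k::field mpoly set"
  assumes "mp.subspace V" "V \<subseteq> forms n d" "h \<in> forms n d" "h \<notin> V"
  shows "codim n d (mp.span (insert h V)) = codim n d V - 1"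
    and "codim n d V > 0"
proof -
  have fd: "mp.finite_dim V" using mp.finite_dim_subset[OF finite_dim_forms assms(2)] .
  have "mp.span (insert h V) \<subseteq> forms n d"
    using assms by (intro mp.span_minimal subspace_forms) auto
  then have "mp.dim (mp.span (insert h V)) \<le> mp.dim (forms n d :: 'k mpoly set)"
    by (intro mp.dim_subspace_mono subspace_forms finite_dim_forms) auto
  moreover have "mp.dim (mp.span (insert h V)) = Suc (mp.dim V)"
    using assms fd by (intro mp.dim_span_insert)
  ultimately show "codim n d (mp.span (insert h V)) = codim n d V - 1" "codim n d V > 0"
    by (simp_all add: codim_def)
qed

lemma subspace_colon:
  assumes "mp.subspace W"
  shows "mp.subspace {q \<in> forms n e. h * q \<in> W}"
proof (rule mp.subspaceI)
  show "0 \<in> {q \<in> forms n e. h * q \<in> W}"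
    using mp.subspace_0[OF assms] by simp
next
  fix x y assume "x \<in> {q \<in> forms n e. h * q \<in> W}" "y \<in> {q \<in> forms n e. h * q \<in> W}"
  then show "x + y \<in> {q \<in> forms n e. h * q \<in> W}"
    using mp.subspace_add[OF assms] by (simp add: distrib_left forms_add)
next
  fix c x assume "x \<in> {q \<in> forms n e. h * q \<in> W}"
  then show "mscale c x \<in> {q \<in> forms n e. h * q \<in> W}"
    using mp.subspace_scale[OF assms] by (simp add: mult_mscale forms_mscale)
qed

lemma subspace_section: "mp.subspace W \<Longrightarrow> mp.subspace (W + (*) h ` forms n e)"
proof (rule mp.subspace_set_plus)
  interpret h: Vector_Spaces.linear mscale mscale "(*) h" by (rule linear_mult)
  show "mp.subspace ((*) h ` forms n e)" by (rule h.subspace_image[OF subspace_forms])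
qed

lemma section_subset:
  assumes "W \<subseteq> forms n (Suc e)" "h \<in> forms n 1"
  shows "W + (*) h ` forms n e \<subseteq> forms n (Suc e)"
  using assms forms_mult[OF assms(2)] by (auto simp: set_plus_def intro!: forms_add)

lemma subset_section: "W \<subseteq> W + (*) h ` forms n e"
proof
  fix w assume "w \<in> W"
  then have "w + h * 0 \<in> W + (*) h ` forms n e" by (intro set_plus_intro imageI) auto
  then show "w \<in> W + (*) h ` forms n e" by simp
qed

text \<open>Writing S_j for \<open>forms n j\<close>, this is the dimension count in the exact
  sequence 0 -> S_e/(W : h) -> S_(e+1)/W -> S_(e+1)/(W + h S_e) -> 0.\<close>

lemma codim_section:
  fixes W :: "'k::field mpoly set"
  assumes "mp.subspace W" "W \<subseteq> forms n (Suc e)" "h \<in> forms n 1"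
  shows "codim n (Suc e) W =
    codim n (Suc e) (W + (*) h ` forms n e) + codim n e {q \<in> forms n e. h * q \<in> W}"
proof -
  have "mp.dim (W + (*) h ` forms n e) + mp.dim {q \<in> forms n e. h * q \<in> W}
      = mp.dim W + mp.dim (forms n e :: 'k mpoly set)"
    using assms mp.finite_dim_subset[OF finite_dim_forms]
    by (intro mp.dim_plus_image linear_mult subspace_forms finite_dim_forms) auto
  moreover have "mp.dim (W + (*) h ` forms n e) \<le> mp.dim (forms n (Suc e) :: 'k mpoly set)"
    using assms by (intro mp.dim_subspace_mono subspace_section section_subset subspace_forms finite_dim_forms)
  moreover have "mp.dim {q \<in> forms n e. h * q \<in> W} \<le> mp.dim (forms n e :: 'k mpoly set)"
    using assms by (intro mp.dim_subspace_mono subspace_colon subspace_forms finite_dim_forms) auto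
  moreover have "mp.dim W \<le> mp.dim (forms n (Suc e) :: 'k mpoly set)"
    using assms by (intro mp.dim_subspace_mono subspace_forms finite_dim_forms) auto
  ultimately show ?thesis unfolding codim_def by linarith
qed

section \<open>Finite covers and the double induction\<close>

text \<open>The members are preimages of proper subspaces of the quotient of
  \<open>forms n 1\<close> by \<open>V\<close>. Containing \<open>V\<close> is what keeps their
  images proper.\<close>

definition proper_cover :: "nat \<Rightarrow> 'k::field mpoly set \<Rightarrow> 'k mpoly set set \<Rightarrow> bool" where
  "proper_cover n V LS \<longleftrightarrow> finite LS \<and> (\<forall>L\<in>LS. mp.subspace L \<and> V \<subseteq> L \<and> L \<subset> forms n 1)"

lemma proper_cover_Un: "proper_cover n V LS \<Longrightarrow> proper_cover n V LS' \<Longrightarrow> proper_cover n V (LS \<union> LS')"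
  by (auto simp: proper_cover_def)

text \<open>A form outside \<open>W\<close> is a new relation and lowers the codimension, so
  \<open>W\<close> is the only exceptional subspace. If \<open>W\<close> is everything, the
  codimension is 0 and the empty cover works.\<close>

lemma hyperplane_restriction_1:
  fixes V W :: "'k::field mpoly set"
  assumes "mp.subspace W" "W \<subseteq> forms n 1" "V \<subseteq> W"
  shows "\<exists>LS. proper_cover n V LS \<and> (\<forall>l \<in> forms n 1 - \<Union>LS.
           codim n 1 (W + (*) l ` forms n 0) \<le> macaulay_lower 1 (codim n 1 W))"
proof (cases "W = forms n 1")
  case True
  have "codim n 1 (W + (*) l ` forms n 0) \<le> codim n 1 W" if "l \<in> forms n 1" for l
    using codim_section[of W n 0 l] assms that by simp
  moreover have "codim n 1 W = 0" using True by (simp add: codim_def)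
  ultimately show ?thesis by (intro exI[of _ "{}"]) (auto simp: proper_cover_def)
next
  case False
  have "codim n 1 (W + (*) l ` forms n 0) \<le> codim n 1 W - 1" if l: "l \<in> forms n 1" "l \<notin> W" for l
  proof -
    have "1 \<in> forms n 0" by (simp add: forms_iff monoms_def monom_degree_def)
    then have "l \<in> W + (*) l ` forms n 0"
      using set_plus_intro[OF mp.subspace_0[OF assms(1)] imageI, of 1 "forms n 0" "(*) l"] by simp
    then have "mp.span (insert l W) \<subseteq> W + (*) l ` forms n 0"
      using subset_section[of W l n 0] assms by (intro mp.span_minimal subspace_section) auto
    then have "codim n 1 (W + (*) l ` forms n 0) \<le> codim n 1 (mp.span (insert l W))"
      using assms l section_subset[of W n 0 l] by (intro codim_antimono subspace_section) auto
    then show ?thesis using codim_insert_less(1)[OF assms(1,2) l] by simp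
  qed
  then show ?thesis using False assms
    by (intro exI[of _ "{W}"]) (auto simp: proper_cover_def macaulay_lower_1)
qed

text \<open>\<open>V\<close> and \<open>W\<close> are the relations in degrees 1 and
  \<open>d\<close>, tied together only by the last assumption. That link survives both adding
  \<open>h\<close> to the relations and passing to the colon by \<open>h\<close>, so no ideal has to
  be carried through the induction on \<open>d\<close> and, inside it, on
  \<open>codim n 1 V\<close>.\<close>

lemma hyperplane_restriction:
  fixes V W :: "'k::field mpoly set"
  assumes "d > 0" "mp.subspace V" "V \<subseteq> forms n 1" "mp.subspace W" "W \<subseteq> forms n d"
    and "\<And>v q. v \<in> V \<Longrightarrow> q \<in> forms n (d - 1) \<Longrightarrow> v * q \<in> W"
  shows "\<exists>LS. proper_cover n V LS \<and> (\<forall>l \<in> forms n 1 - \<Union>LS.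
           codim n d (W + (*) l ` forms n (d - 1)) \<le> macaulay_lower d (codim n d W))"
  using assms
proof (induction d arbitrary: V W)
  case (Suc e V W)
  note IHd = Suc.IH
  show ?case
  proof (cases "e = 0")
    case True
    have "V \<subseteq> W"
    proof
      fix v assume "v \<in> V"
      have "1 \<in> forms n 0" by (simp add: forms_iff monoms_def monom_degree_def)
      then show "v \<in> W" using Suc.prems(6)[OF \<open>v \<in> V\<close>, of 1] True by simp
    qed
    then show ?thesis using hyperplane_restriction_1[of W n V] Suc.prems True by simp
  next
    case False
    then obtain e' where e': "e = Suc e'" by (cases e) auto
    show ?thesis using Suc.prems(2-6)
    proof (induction "codim n 1 V" arbitrary: V W rule: less_induct)
      case (less V W)
      let ?F = "forms n e :: 'k mpoly set"
      let ?cd = "\<lambda>l. codim n (Suc e) (W + (*) l ` ?F)"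
      let ?c = "codim n (Suc e) W"
      have cd_le: "?cd l \<le> ?c" if "l \<in> forms n 1" for l
        using codim_section[OF less.prems(3,4) that] by simp
      show ?case
      proof (cases "V = forms n 1")
        case True
        then have "forms n (Suc e) \<subseteq> W" using less.prems by (intro forms_Suc_subset) auto
        then have "?c = 0" using less.prems by (simp add: codim_def subset_antisym)
        then show ?thesis using cd_le by (intro exI[of _ "{}"]) (auto simp: proper_cover_def)
      next
        case V: False
        let ?P = "\<lambda>M. \<exists>LS. proper_cover n V LS \<and> (\<forall>l \<in> forms n 1 - \<Union>LS. ?cd l \<le> M)"
        define M where "M = (LEAST M. ?P M)"
        have "?P ?c" using cd_le by (intro exI[of _ "{}"]) (auto simp: proper_cover_def)
        then have "?P M" unfolding M_def by (rule LeastI)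
        then obtain LS0 where LS0: "proper_cover n V LS0" "\<forall>l \<in> forms n 1 - \<Union>LS0. ?cd l \<le> M"
          by blast
        have "M \<le> macaulay_lower (Suc e) ?c"
        proof (cases "M = 0")
          case False
          \<comment> \<open>If \<open>LS\<close> contained all forms attaining \<open>M\<close>,
            then \<open>LS\<close> and \<open>LS0\<close> together would witness
            \<open>?P (M - 1)\<close>, against minimality. This needs \<open>M > 0\<close>, as
            \<open>M - 1\<close> truncates.\<close>
          have dense: "\<exists>l \<in> forms n 1 - \<Union>LS. ?cd l = M" if "proper_cover n V LS" for LS
          proof -
            have "\<not> ?P (M - 1)" using not_less_Least[of "M - 1" ?P] False unfolding M_def by simp
            moreover have "proper_cover n V (LS \<union> LS0)" using that LS0(1) by (rule proper_cover_Un)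
            ultimately obtain l where l: "l \<in> forms n 1 - \<Union>(LS \<union> LS0)" "\<not> ?cd l \<le> M - 1" by blast
            then have "?cd l \<le> M" using LS0(2) by auto
            then show ?thesis using l by (intro bexI[of _ l]) auto
          qed
          \<comment> \<open>The cover \<open>{V}\<close> forces \<open>h\<close> outside
            \<open>V\<close>, so that adding \<open>h\<close> lowers the inner induction
            measure.\<close>
          have "proper_cover n V {V}" using V less.prems by (auto simp: proper_cover_def)
          from dense[OF this] obtain h where h: "h \<in> forms n 1" "h \<notin> V" "?cd h = M" by auto

          define V' where "V' = mp.span (insert h V)"
          define W' where "W' = W + (*) h ` ?F"
          have W': "mp.subspace W'" "W' \<subseteq> forms n (Suc e)"
            unfolding W'_def
            by (rule subspace_section[OF less.prems(3)], rule section_subset[OF less.prems(4) h(1)])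
          have VV': "V \<subseteq> V'" using mp.span_superset[of "insert h V"] by (auto simp: V'_def)
          have "\<exists>LS. proper_cover n V' LS \<and> (\<forall>l \<in> forms n 1 - \<Union>LS.
              codim n (Suc e) (W' + (*) l ` forms n (Suc e - 1))
                \<le> macaulay_lower (Suc e) (codim n (Suc e) W'))"
          proof (rule less.hyps)
            show "codim n 1 V' < codim n 1 V"
              using codim_insert_less[OF less.prems(1,2) h(1,2)] by (simp add: V'_def)
            show "mp.subspace V'" by (simp add: V'_def)
            show "V' \<subseteq> forms n 1"
              unfolding V'_def using less.prems h by (intro mp.span_minimal subspace_forms) auto
            fix v q :: "'k mpoly" assume v: "v \<in> V'" and q: "q \<in> forms n (Suc e - 1)"
            obtain k u where ku: "u \<in> V" "v = mscale k h + u"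
              using v mp.mem_span_insert_subspace[OF less.prems(1)] unfolding V'_def by blast
            have "mscale k q \<in> ?F" using q by (simp add: forms_mscale)
            moreover have "v * q = u * q + h * mscale k q"
              unfolding ku(2) mscale_def by (simp add: algebra_simps)
            ultimately show "v * q \<in> W'"
              using less.prems(5)[OF ku(1) q] by (auto simp: W'_def set_plus_def)
          qed (use W' in auto)
          then obtain LS1 where LS1: "proper_cover n V' LS1"
            "\<forall>l \<in> forms n 1 - \<Union>LS1. codim n (Suc e) (W' + (*) l ` ?F) \<le> macaulay_lower (Suc e) M"
            using h(3) by (auto simp: W'_def)

          define W2 where "W2 = {q \<in> ?F. h * q \<in> W}"
          have W2: "mp.subspace W2" unfolding W2_def by (rule subspace_colon[OF less.prems(3)])
          have codim_W2: "codim n e W2 = ?c - M"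
            using codim_section[OF less.prems(3,4) h(1)] h(3) by (simp add: W2_def)
          \<comment> \<open>The outer hypothesis is used with the same \<open>V\<close>:
            multiplications by \<open>v\<close> and \<open>h\<close> commute, so \<open>W2\<close>
            absorbs the products with \<open>V\<close>.\<close>
          have "\<exists>LS. proper_cover n V LS \<and> (\<forall>l \<in> forms n 1 - \<Union>LS.
              codim n e (W2 + (*) l ` forms n (e - 1)) \<le> macaulay_lower e (codim n e W2))"
          proof (rule IHd)
            fix v q :: "'k mpoly" assume v: "v \<in> V" and q: "q \<in> forms n (e - 1)"
            have "v * q \<in> ?F" using forms_mult[of v n 1 q "e - 1"] v q less.prems(2) e' by auto
            moreover have "h * q \<in> ?F" using forms_mult[OF h(1) q] e' by simp
            then have "v * (h * q) \<in> W" using less.prems(5)[OF v] by simp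
            then have "h * (v * q) \<in> W" by (simp add: mult.left_commute)
            ultimately show "v * q \<in> W2" by (simp add: W2_def)
          qed (use less.prems False e' W2 in \<open>auto simp: W2_def\<close>)
          then obtain LS2 where LS2: "proper_cover n V LS2"
            "\<forall>l \<in> forms n 1 - \<Union>LS2. codim n e (W2 + (*) l ` forms n e') \<le> macaulay_lower e (?c - M)"
            using codim_W2 e' by auto

          \<comment> \<open>Members of \<open>LS1\<close> contain \<open>V'\<close>, hence
            \<open>V\<close>, so a form attaining \<open>M\<close> can avoid both covers at
            once.\<close>
          have "proper_cover n V (LS1 \<union> LS2)"
            using LS1(1) LS2(1) VV' by (auto simp: proper_cover_def)
          from dense[OF this] obtain l where l: "l \<in> forms n 1" "l \<notin> \<Union>LS1" "l \<notin> \<Union>LS2" "?cd l = M"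
            by auto
          define X where "X = W + (*) l ` ?F"
          have X: "mp.subspace X" "X \<subseteq> forms n (Suc e)"
            unfolding X_def
            by (rule subspace_section[OF less.prems(3)], rule section_subset[OF less.prems(4) l(1)])
          \<comment> \<open>The sequence is applied to \<open>X\<close> and \<open>h\<close>. Its
            quotient term is symmetric in \<open>h\<close> and \<open>l\<close>, and the colon of
            \<open>X\<close> contains the section of \<open>W2\<close> by \<open>l\<close>, so its
            codimension is at most that of the section.\<close>
          have "M = codim n (Suc e) X" using l(4) by (simp add: X_def)
          also have "\<dots> = codim n (Suc e) (X + (*) h ` ?F) + codim n e {q \<in> ?F. h * q \<in> X}"
            using codim_section[OF X h(1)] .
          also have "X + (*) h ` ?F = W' + (*) l ` ?F"
            by (simp add: X_def W'_def add_ac)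
          also have "codim n (Suc e) (W' + (*) l ` ?F) \<le> macaulay_lower (Suc e) M"
            using LS1(2) l by auto
          also have "codim n e {q \<in> ?F. h * q \<in> X} \<le> codim n e (W2 + (*) l ` forms n e')"
          proof (rule codim_antimono)
            show "W2 + (*) l ` forms n e' \<subseteq> {q \<in> ?F. h * q \<in> X}"
            proof safe
              fix x assume "x \<in> W2 + (*) l ` forms n e'"
              then obtain w q where wq: "w \<in> W2" "q \<in> forms n e'" "x = w + l * q"
                by (auto simp: set_plus_def)
              have "l * q \<in> ?F" using forms_mult[OF l(1) wq(2)] e' by simp
              then show "x \<in> ?F" using wq by (simp add: W2_def forms_add)
              have "h * q \<in> ?F" using forms_mult[OF h(1) wq(2)] e' by simp
              moreover have "h * x = h * w + l * (h * q)" using wq(3) by (simp add: algebra_simps)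
              ultimately show "h * x \<in> X" using wq(1) by (auto simp: X_def W2_def set_plus_def)
            qed
          qed (use W2 subspace_section subspace_colon[OF X(1)] in auto)
          also have "\<dots> \<le> macaulay_lower e (?c - M)" using LS2(2) l by auto
          finally have "M \<le> macaulay_lower (Suc e) M + macaulay_lower e (?c - M)" by simp
          moreover have "M \<le> ?c" using cd_le[OF l(1)] l(4) by simp
          ultimately show ?thesis using le_macaulay_lower[of "Suc e" M ?c] by simp
        qed simp
        then have "?cd l \<le> macaulay_lower (Suc e) ?c" if "l \<in> forms n 1 - \<Union>LS0" for l
          using LS0(2) that by (blast intro: le_trans)
        then show ?thesis using LS0(1) unfolding diff_Suc_1 by blast
      qed
    qed
  qed
qed simp

section \<open>Homogeneous ideals and dimensions in quotient rings\<close>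

lemma carrier_mpoly_ring:
  "carrier (mpoly_ring n) = {p. \<forall>m \<in> Poly_Mapping.keys p. Poly_Mapping.keys m \<subseteq> {..<n}}"
  by (simp add: mpoly_ring_def)

lemma mpoly_ring_simps [simp]:
  "mult (mpoly_ring n) = (*)" "one (mpoly_ring n) = 1" "zero (mpoly_ring n) = 0" "add (mpoly_ring n) = (+)"
  by (simp_all add: mpoly_ring_def)

lemmas ring_mpoly_ring = cring.axioms(1)[OF cring_mpoly_ring]

lemma forms_subset_carrier: "forms n d \<subseteq> carrier (mpoly_ring n)"
  by (auto simp: forms_def)

lemma single_0_in_carrier: "Poly_Mapping.single 0 c \<in> carrier (mpoly_ring n)"
  by (simp add: carrier_mpoly_ring)

lemma subspace_carrier: "mp.subspace (carrier (mpoly_ring n))"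
proof -
  interpret P: cring "mpoly_ring n :: 'a mpoly ring" by (rule cring_mpoly_ring)
  show "mp.subspace (carrier (mpoly_ring n) :: 'a mpoly set)"
    using P.zero_closed P.a_closed P.m_closed[OF single_0_in_carrier]
    by (intro mp.subspaceI) (auto simp: mscale_def)
qed

lemma a_inv_mpoly_ring:
  assumes "p \<in> carrier (mpoly_ring n)"
  shows "\<ominus>\<^bsub>mpoly_ring n\<^esub> p = - p"
proof -
  interpret P: cring "mpoly_ring n :: 'a mpoly ring" by (rule cring_mpoly_ring)
  show ?thesis
    using assms mp.subspace_neg[OF subspace_carrier assms] by (intro P.minus_equality) auto
qed

lemma subspace_imp_subgroup:
  assumes "mp.subspace W" "W \<subseteq> carrier (mpoly_ring n)"
  shows "subgroup W (add_monoid (mpoly_ring n))"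
proof -
  interpret P: cring "mpoly_ring n :: 'a mpoly ring" by (rule cring_mpoly_ring)
  show ?thesis
  proof (rule P.add.subgroupI)
    show "W \<noteq> {}" using mp.subspace_0[OF assms(1)] by blast
    fix a b assume ab: "a \<in> W" "b \<in> W"
    then show "a \<oplus>\<^bsub>mpoly_ring n\<^esub> b \<in> W" using mp.subspace_add[OF assms(1)] by simp
    show "\<ominus>\<^bsub>mpoly_ring n\<^esub> a \<in> W"
      using ab assms mp.subspace_neg[OF assms(1)] by (subst a_inv_mpoly_ring) auto
  qed (use assms in simp)
qed

lemma subspace_ideal:
  assumes "ideal I (mpoly_ring n)"
  shows "mp.subspace I"
proof -
  interpret I: ideal I "mpoly_ring n" by fact
  show ?thesis
    using additive_subgroup.zero_closed[OF I.is_additive_subgroup]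
      additive_subgroup.a_closed[OF I.is_additive_subgroup] I.I_l_closed[OF _ single_0_in_carrier]
    by (intro mp.subspaceI) (auto simp: mscale_def)
qed

section \<open>Homogeneous components\<close>

definition hcomp :: "nat \<Rightarrow> 'k::field mpoly \<Rightarrow> 'k mpoly" where
  "hcomp j p = (\<Sum>m | m \<in> Poly_Mapping.keys p \<and> monom_degree m = j.
                  Poly_Mapping.single m (Poly_Mapping.lookup p m))"

lemma lookup_hcomp:
  "Poly_Mapping.lookup (hcomp j p) m = (if monom_degree m = j then Poly_Mapping.lookup p m else 0)"
  by (auto simp: hcomp_def lookup_sum lookup_single when_def in_keys_iff)

lemma hcomp_add: "hcomp j (p + q) = hcomp j p + hcomp j q"
  by (rule poly_mapping_eqI) (simp add: lookup_hcomp lookup_add)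

lemma hcomp_diff: "hcomp j (p - q) = hcomp j p - hcomp j q"
  by (rule poly_mapping_eqI) (simp add: lookup_hcomp lookup_minus)

lemma hcomp_0 [simp]: "hcomp j 0 = 0"
  by (rule poly_mapping_eqI) (simp add: lookup_hcomp)

lemma keys_hcomp: "Poly_Mapping.keys (hcomp j p) = {m \<in> Poly_Mapping.keys p. monom_degree m = j}"
  by (auto simp: in_keys_iff lookup_hcomp split: if_splits)

lemma hcomp_in_forms: "p \<in> carrier (mpoly_ring n) \<Longrightarrow> hcomp j p \<in> forms n j"
  by (auto simp: forms_def carrier_mpoly_ring keys_hcomp)

lemma hcomp_homogeneous:
  assumes "\<forall>m \<in> Poly_Mapping.keys p. monom_degree m = d"
  shows "hcomp j p = (if j = d then p else 0)"
  using assms by (intro poly_mapping_eqI) (auto simp: lookup_hcomp in_keys_iff)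

lemma hcomp_forms: "p \<in> forms n d \<Longrightarrow> hcomp j p = (if j = d then p else 0)"
  by (rule hcomp_homogeneous) (simp add: forms_def)

text \<open>Split \<open>p\<close> into its component of degree \<open>i - e\<close> and the rest;
  \<open>g\<close> times the rest has no monomial of degree \<open>i\<close>. The case
  \<open>i < e\<close> is separate because \<open>i - e\<close> truncates.\<close>

lemma hcomp_mult:
  assumes g: "\<forall>m \<in> Poly_Mapping.keys g. monom_degree m = e"
  shows "hcomp i (g * p) = (if e \<le> i then g * hcomp (i - e) p else 0)"
proof (cases "e \<le> i")
  case True
  define r where "r = p - hcomp (i - e) p"
  have "hcomp i (g * hcomp (i - e) p) = g * hcomp (i - e) p"
  proof -
    have "monom_degree m = i" if "m \<in> Poly_Mapping.keys (g * hcomp (i - e) p)" for m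
      using that keys_mult[of g "hcomp (i - e) p"] g True
      by (auto simp: keys_hcomp monom_degree_add)
    then show ?thesis by (subst hcomp_homogeneous[of _ i]) auto
  qed
  moreover have "hcomp i (g * r) = 0"
  proof -
    have "monom_degree m \<noteq> i" if m: "m \<in> Poly_Mapping.keys (g * r)" for m
    proof -
      obtain a b where ab: "m = a + b" "a \<in> Poly_Mapping.keys g" "b \<in> Poly_Mapping.keys r"
        using m keys_mult[of g r] by auto
      have "monom_degree b \<noteq> i - e"
        using ab(3) by (auto simp: r_def in_keys_iff lookup_minus lookup_hcomp)
      then show ?thesis using ab g by (auto simp: monom_degree_add)
    qed
    then show ?thesis by (intro poly_mapping_eqI) (auto simp: lookup_hcomp in_keys_iff)
  qed
  moreover have "g * p = g * hcomp (i - e) p + g * r" by (simp add: r_def algebra_simps)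
  ultimately show ?thesis using True by (simp add: hcomp_add)
next
  case False
  have "monom_degree m \<noteq> i" if "m \<in> Poly_Mapping.keys (g * p)" for m
    using that keys_mult[of g p] g False by (auto simp: monom_degree_add)
  then show ?thesis using False by (intro poly_mapping_eqI) (auto simp: lookup_hcomp in_keys_iff)
qed

lemma homogeneous_ideal_imp_ideal:
  assumes "homogeneous_ideal n I"
  shows "ideal I (mpoly_ring n)"
proof -
  obtain G where G: "G \<subseteq> (\<Union>j. forms n j)" "I = Idl\<^bsub>mpoly_ring n\<^esub> G"
    using assms unfolding homogeneous_ideal_def by blast
  show ?thesis unfolding G(2)
    using G(1) forms_subset_carrier by (intro ring.genideal_ideal ring_mpoly_ring) blast
qed

text \<open>The polynomials all of whose components lie in \<open>I\<close> form an ideal that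
  contains the homogeneous generators, hence \<open>I\<close>.\<close>

lemma hcomp_mem_homogeneous_ideal:
  assumes "homogeneous_ideal n I" "p \<in> I"
  shows "hcomp j p \<in> I"
proof -
  interpret I: ideal I "mpoly_ring n" using assms(1) by (rule homogeneous_ideal_imp_ideal)
  have sI: "mp.subspace I" by (rule subspace_ideal) (rule I.is_ideal)
  obtain G where G: "G \<subseteq> (\<Union>j. forms n j)" "I = Idl\<^bsub>mpoly_ring n\<^esub> G"
    using assms(1) unfolding homogeneous_ideal_def by blast
  define J where "J = {p \<in> carrier (mpoly_ring n). \<forall>j. hcomp j p \<in> I}"
  have hs: "hcomp j (mscale c p) = mscale c (hcomp j p)" for j c p
    using hcomp_mult[of "Poly_Mapping.single 0 c" 0 j p] by (simp add: mscale_def monom_degree_def)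
  have sJ: "mp.subspace J"
    using mp.subspace_0[OF subspace_carrier, of n] mp.subspace_add[OF subspace_carrier, of _ n]
      mp.subspace_scale[OF subspace_carrier, of _ n] mp.subspace_0[OF sI] mp.subspace_add[OF sI]
      mp.subspace_scale[OF sI]
    unfolding J_def by (intro mp.subspaceI) (auto simp: hcomp_add hs)
  have closed: "q * p \<in> J" if p: "p \<in> J" and q: "q \<in> carrier (mpoly_ring n)" for p q
  proof -
    \<comment> \<open>The condition is linear in \<open>q\<close>, which reduces it to monomials;
      multiplying by one of these only shifts components.\<close>
    have "mp.subspace {q. q * p \<in> J}"
      using sJ unfolding mp.subspace_def
      by (auto simp: distrib_right mscale_def mult.assoc)
    moreover have "Poly_Mapping.single m 1 \<in> {q. q * p \<in> J}" if "m \<in> Poly_Mapping.keys q" for m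
    proof -
      let ?g = "Poly_Mapping.single m 1 :: 'a mpoly"
      have g: "?g \<in> carrier (mpoly_ring n)" using q that by (simp add: carrier_mpoly_ring)
      have "hcomp j (?g * p) \<in> I" for j
        using hcomp_mult[of ?g "monom_degree m" j p] p I.I_l_closed[OF _ g] mp.subspace_0[OF sI]
        by (simp add: J_def)
      moreover have "?g * p \<in> carrier (mpoly_ring n)"
        using I.m_closed[OF g, of p] p by (simp add: J_def)
      ultimately show ?thesis by (simp add: J_def)
    qed
    ultimately have "q \<in> {q. q * p \<in> J}" by (rule mem_subspace_monoms)
    then show ?thesis by simp
  qed
  have "ideal J (mpoly_ring n)"
  proof (rule idealI[OF ring_mpoly_ring])
    show "subgroup J (add_monoid (mpoly_ring n))"
      using sJ by (rule subspace_imp_subgroup) (simp add: J_def)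
  qed (use closed in \<open>auto simp: mult.commute\<close>)
  moreover have "G \<subseteq> J"
  proof
    fix g assume "g \<in> G"
    then obtain e where e: "g \<in> forms n e" using G(1) by blast
    have "G \<subseteq> carrier (mpoly_ring n)" using G(1) forms_subset_carrier by blast
    then have "g \<in> I" unfolding G(2) using ring.genideal_self[OF ring_mpoly_ring] \<open>g \<in> G\<close> by blast
    then show "g \<in> J"
      using e forms_subset_carrier hcomp_forms[OF e] mp.subspace_0[OF sI] by (auto simp: J_def)
  qed
  ultimately have "I \<subseteq> J" unfolding G(2) by (rule ring.genideal_minimal[OF ring_mpoly_ring])
  then show ?thesis using assms(2) by (auto simp: J_def)
qed

section \<open>Dimension over the image of the scalars\<close>

lemma subfield_scalars: "subfield (range (Poly_Mapping.single 0)) (mpoly_ring n :: 'k::field mpoly ring)"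
proof -
  interpret P: cring "mpoly_ring n :: 'k mpoly ring" by (rule cring_mpoly_ring)
  let ?K = "range (Poly_Mapping.single 0) :: 'k mpoly set"
  show ?thesis
  proof (rule P.subfieldI)
    show "subcring ?K (mpoly_ring n)"
    proof (rule P.subcringI'[OF P.subringI])
      show "?K \<subseteq> carrier (mpoly_ring n)" using single_0_in_carrier by blast
      show "\<one>\<^bsub>mpoly_ring n\<^esub> \<in> ?K" by (simp add: image_iff) (metis single_one)
      fix h assume h: "h \<in> ?K"
      then obtain c where c: "h = Poly_Mapping.single 0 c" by blast
      show "\<ominus>\<^bsub>mpoly_ring n\<^esub> h \<in> ?K"
        unfolding c by (subst a_inv_mpoly_ring[OF single_0_in_carrier]) (metis rangeI single_uminus)
      fix h' assume "h' \<in> ?K"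
      then obtain c' where c': "h' = Poly_Mapping.single 0 c'" by blast
      show "h \<otimes>\<^bsub>mpoly_ring n\<^esub> h' \<in> ?K" by (simp add: c c' mult_single)
      show "h \<oplus>\<^bsub>mpoly_ring n\<^esub> h' \<in> ?K" by (simp add: c c' single_add[symmetric])
    qed
    show "Units (mpoly_ring n\<lparr>carrier := ?K\<rparr>) = ?K - {\<zero>\<^bsub>mpoly_ring n\<^esub>}"
    proof (intro subset_antisym subsetI)
      fix x assume "x \<in> Units (mpoly_ring n\<lparr>carrier := ?K\<rparr>)"
      then show "x \<in> ?K - {\<zero>\<^bsub>mpoly_ring n\<^esub>}" by (auto simp: Units_def)
    next
      fix x assume "x \<in> ?K - {\<zero>\<^bsub>mpoly_ring n\<^esub>}"
      then obtain c where "x = Poly_Mapping.single 0 c" "x \<noteq> 0" by auto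
      then have c: "x = Poly_Mapping.single 0 c" "c \<noteq> 0" by auto
      then have "Poly_Mapping.single 0 (inverse c) * x = 1" "x * Poly_Mapping.single 0 (inverse c) = 1"
        by (simp_all add: mult_single)
      then show "x \<in> Units (mpoly_ring n\<lparr>carrier := ?K\<rparr>)" using c by (auto simp: Units_def)
    qed
  qed
qed

text \<open>Links the two notions of dimension. On the way from the kernel up to \<open>U\<close>,
  each new \<open>v\<close> has \<open>h v\<close> outside the current image because the kernel lies
  in \<open>U'\<close>, so \<open>Suc_dim\<close> applies.\<close>

lemma dimension_image:
  fixes A :: "('a, 'b) ring_scheme" and U :: "'k::field mpoly set"
  assumes "ring A" and h: "h \<in> ring_hom (mpoly_ring n) A"
    and U: "mp.subspace U" "U \<subseteq> carrier (mpoly_ring n)" "mp.finite_dim U"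
  shows "ring.dimension A (mp.dim U - mp.dim {u \<in> U. h u = \<zero>\<^bsub>A\<^esub>}) (h ` range (Poly_Mapping.single 0)) (h ` U)"
proof -
  interpret A: ring A by fact
  interpret h: ring_hom_ring "mpoly_ring n" A h
    using ring_hom_ringI2[OF ring_mpoly_ring assms(1) h] .
  define N where "N = {u \<in> U. h u = \<zero>\<^bsub>A\<^esub>}"
  have h_add: "h (x + y) = h x \<oplus>\<^bsub>A\<^esub> h y"
    if "x \<in> carrier (mpoly_ring n)" "y \<in> carrier (mpoly_ring n)" for x y
    using h.hom_add[OF that] by simp
  have h_mult: "h (x * y) = h x \<otimes>\<^bsub>A\<^esub> h y"
    if "x \<in> carrier (mpoly_ring n)" "y \<in> carrier (mpoly_ring n)" for x y
    using h.hom_mult[OF that] by simp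
  have h0: "h 0 = \<zero>\<^bsub>A\<^esub>" using h.hom_zero by simp
  have N: "mp.subspace N"
  proof (rule mp.subspaceI)
    show "0 \<in> N" using mp.subspace_0[OF U(1)] h0 by (simp add: N_def)
  next
    fix x y assume "x \<in> N" "y \<in> N"
    then show "x + y \<in> N" using mp.subspace_add[OF U(1)] U(2) by (auto simp: N_def h_add subset_iff)
  next
    fix c x assume x: "x \<in> N"
    then have "h (mscale c x) = h (Poly_Mapping.single 0 c) \<otimes>\<^bsub>A\<^esub> \<zero>\<^bsub>A\<^esub>"
      unfolding mscale_def using U(2) single_0_in_carrier by (subst h_mult) (auto simp: N_def)
    then show "mscale c x \<in> N"
      using x mp.subspace_scale[OF U(1)] h.hom_closed[OF single_0_in_carrier, of c] by (simp add: N_def)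
  qed
  have "N \<subseteq> U" unfolding N_def by blast
  from N U(1) this U(3) show ?thesis unfolding N_def[symmetric]
  proof (induction rule: mp.subspace_chain_induct)
    case base
    have "h ` N = {\<zero>\<^bsub>A\<^esub>}" using mp.subspace_0[OF N] by (auto simp: image_iff N_def)
    then show ?case using A.zero_dim by simp
  next
    case (step U' v)
    have U'c: "U' \<subseteq> carrier (mpoly_ring n)" and v: "v \<in> carrier (mpoly_ring n)"
      using step U(2) by auto
    have fd: "mp.finite_dim U'" using mp.finite_dim_subset[OF U(3)] step by blast
    have "h v \<notin> h ` U'"
    proof
      assume "h v \<in> h ` U'"
      then obtain u where u: "u \<in> U'" "h v = h u" by blast
      have uc: "u \<in> carrier (mpoly_ring n)" using u U'c by blast
      then have "- u \<in> carrier (mpoly_ring n)" using mp.subspace_neg[OF subspace_carrier] by blast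
      then have "h (v - u) = h u \<oplus>\<^bsub>A\<^esub> h (- u)" using h_add[OF v, of "- u"] u(2) by simp
      also have "\<dots> = h 0" using h_add[OF uc \<open>- u \<in> _\<close>] by simp
      finally have "v - u \<in> N" using u step mp.subspace_diff[OF U(1)] h0 by (auto simp: N_def)
      then have "v - u \<in> U'" using step(2) by blast
      then show False using mp.subspace_add[OF step(1), of "v - u" u] u step(5) by simp
    qed
    then have "A.dimension (Suc (mp.dim U' - mp.dim N)) (h ` range (Poly_Mapping.single 0))
        (A.line_extension (h ` range (Poly_Mapping.single 0)) (h v) (h ` U'))"
      using step.IH v by (intro A.Suc_dim) auto
    moreover have "A.line_extension (h ` range (Poly_Mapping.single 0)) (h v) (h ` U')
        = h ` mp.span (insert v U')"
    proof (rule Set.set_eqI)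
      fix x
      have "h (mscale k v + u) = h (Poly_Mapping.single 0 k) \<otimes>\<^bsub>A\<^esub> h v \<oplus>\<^bsub>A\<^esub> h u" if "u \<in> U'" for k u
        using that U'c v single_0_in_carrier[of k n] h.R.m_closed[of "Poly_Mapping.single 0 k" v]
        by (auto simp: mscale_def h_add h_mult subset_iff)
      moreover have "x \<in> h ` mp.span (insert v U') \<longleftrightarrow> (\<exists>k. \<exists>u\<in>U'. x = h (mscale k v + u))"
        unfolding image_iff Bex_def mp.mem_span_insert_subspace[OF step(1)] by blast
      ultimately show "x \<in> A.line_extension (h ` range (Poly_Mapping.single 0)) (h v) (h ` U') \<longleftrightarrow>
          x \<in> h ` mp.span (insert v U')"
        unfolding A.line_extension_mem_iff by auto
    qed
    moreover have "mp.dim (mp.span (insert v U')) = Suc (mp.dim U')"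
      using step fd by (intro mp.dim_span_insert)
    moreover have "mp.dim N \<le> mp.dim U'"
      using N step fd by (intro mp.dim_subspace_mono)
    ultimately show ?case by (simp add: Suc_diff_le)
  qed
qed

text \<open>In the zero ring the image of the scalars is not a subfield, so uniqueness of the dimension
  needs its own argument there.\<close>

lemma ring_dim_image:
  fixes A :: "('a, 'b) ring_scheme" and U :: "'k::field mpoly set"
  assumes "ring A" and h: "h \<in> ring_hom (mpoly_ring n) A"
    and U: "mp.subspace U" "U \<subseteq> carrier (mpoly_ring n)" "mp.finite_dim U"
  shows "ring.dim A (h ` range (Poly_Mapping.single 0)) (h ` U) = mp.dim U - mp.dim {u \<in> U. h u = \<zero>\<^bsub>A\<^esub>}"
proof -
  interpret A: ring A by fact
  interpret h: ring_hom_ring "mpoly_ring n" A h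
    using ring_hom_ringI2[OF ring_mpoly_ring assms(1) h] .
  note dim = dimension_image[OF assms]
  show ?thesis
  proof (cases "\<one>\<^bsub>A\<^esub> = \<zero>\<^bsub>A\<^esub>")
    case True
    then have trivial: "carrier A = {\<zero>\<^bsub>A\<^esub>}" by (rule A.one_zeroD)
    \<comment> \<open>Zero is the only element, so \<open>Suc_dim\<close> never finds a vector
      outside the space.\<close>
    have unique: "m = 0 \<and> E = {\<zero>\<^bsub>A\<^esub>}" if "A.dimension m K E" for m K E
      using that by induction (auto simp: trivial)
    show ?thesis unfolding A.dim_def
    proof (rule the_equality, rule dim)
      fix m
      assume "A.dimension m (h ` range (Poly_Mapping.single 0)) (h ` U)"
      then show "m = mp.dim U - mp.dim {u \<in> U. h u = \<zero>\<^bsub>A\<^esub>}"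
        using unique dim by (metis (no_types, lifting))
    qed
  next
    case False
    have "subfield (h ` range (Poly_Mapping.single 0)) A"
      by (rule h.img_is_subfield(2)[OF subfield_scalars False])
    from A.dimI[OF this dim] show ?thesis by (simp add: over_def)
  qed
qed

lemma coset_eq_iff:
  assumes "ideal I (mpoly_ring n)" "x \<in> carrier (mpoly_ring n)" "y \<in> carrier (mpoly_ring n)"
  shows "I +>\<^bsub>mpoly_ring n\<^esub> x = I +>\<^bsub>mpoly_ring n\<^esub> y \<longleftrightarrow> x - y \<in> I"
  using ring.quotient_eq_iff_same_a_r_cos[OF ring_mpoly_ring assms] a_inv_mpoly_ring[OF assms(3)]
  by (simp add: a_minus_def)

section \<open>Degree parts of R and R/lR as codimensions\<close>

lemma zero_FactRing: "\<zero>\<^bsub>R Quot I\<^esub> = I"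
  by (simp add: FactRing_def)

lemma dim_part_eq:
  assumes "homogeneous_ideal n I"
  shows "dim_part n I d = codim n d (I \<inter> forms n d)"
proof -
  interpret I: ideal I "mpoly_ring n" using assms by (rule homogeneous_ideal_imp_ideal)
  have "{u \<in> forms n d. I +>\<^bsub>mpoly_ring n\<^esub> u = I} = I \<inter> forms n d"
    using forms_subset_carrier I.rcos_const_imp_mem I.a_rcos_zero[OF I.is_ideal] by blast
  then show ?thesis
    using ring_dim_image[OF I.quotient_is_ring I.rcos_ring_hom subspace_forms forms_subset_carrier
        finite_dim_forms, of d]
    by (simp add: dim_part_def std_alg_def std_alg_scalars_def std_alg_part_def quot_image_def
        codim_def zero_FactRing)
qed

text \<open>The right side comes from the kernel of the composite projection onto R/lR in degree
  \<open>d\<close>. Homogeneity of \<open>I\<close> allows the cofactor of \<open>l\<close> to be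
  chosen as a form of degree \<open>d - 1\<close>.\<close>

lemma dim_section_part_eq:
  fixes I :: "'k::field mpoly set"
  assumes "homogeneous_ideal n I" "l \<in> forms n 1" "d > 0"
  shows "dim_section_part n I (I +>\<^bsub>mpoly_ring n\<^esub> l) d
    = codim n d (I \<inter> forms n d + (*) l ` forms n (d - 1))"
proof -
  interpret I: ideal I "mpoly_ring n" using assms(1) by (rule homogeneous_ideal_imp_ideal)
  let ?P = "mpoly_ring n :: 'k mpoly ring"
  let ?R = "?P Quot I"
  let ?q = "\<lambda>x. I +>\<^bsub>?P\<^esub> x"
  let ?J = "PIdl\<^bsub>?R\<^esub> ?q l"
  interpret R: cring ?R by (rule I.quotient_is_cring[OF cring_mpoly_ring])
  have lc: "l \<in> carrier ?P" using assms(2) forms_subset_carrier by blast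
  have q: "?q \<in> ring_hom ?P ?R" by (rule I.rcos_ring_hom)
  have "?q l \<in> carrier ?R" using ring_hom_memE(1)[OF q lc] .
  then interpret J: ideal ?J ?R by (rule R.cgenideal_ideal)
  let ?h = "\<lambda>x. ?J +>\<^bsub>?R\<^esub> ?q x"
  have h: "?h \<in> ring_hom ?P (?R Quot ?J)"
    using ring_hom_trans[OF q J.rcos_ring_hom] by (simp add: comp_def)
  have carrier_R: "carrier ?R = ?q ` carrier ?P"
    by (auto simp: FactRing_def A_RCOSETS_def')
  have "?h x = ?J \<longleftrightarrow> x \<in> I \<inter> forms n d + (*) l ` forms n (d - 1)" if x: "x \<in> forms n d" for x
  proof -
    have xc: "x \<in> carrier ?P" using x forms_subset_carrier by blast
    have "?h x = ?J \<longleftrightarrow> ?q x \<in> ?J"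
      using J.rcos_const_imp_mem R.a_rcos_zero[OF J.is_ideal] ring_hom_memE(1)[OF q xc] by blast
    also have "\<dots> \<longleftrightarrow> (\<exists>y \<in> carrier ?P. ?q x = ?q y \<otimes>\<^bsub>?R\<^esub> ?q l)"
      by (auto simp: cgenideal_def carrier_R)
    also have "\<dots> \<longleftrightarrow> (\<exists>y \<in> carrier ?P. ?q x = ?q (y * l))"
      using ring_hom_memE(2)[OF q _ lc] by auto
    also have "\<dots> \<longleftrightarrow> (\<exists>y \<in> carrier ?P. x - l * y \<in> I)"
      using coset_eq_iff[OF I.is_ideal xc] I.m_closed[OF _ lc] by (auto simp: mult.commute)
    also have "\<dots> \<longleftrightarrow> x \<in> I \<inter> forms n d + (*) l ` forms n (d - 1)"
    proof
      assume "\<exists>y \<in> carrier ?P. x - l * y \<in> I"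
      then obtain y where y: "y \<in> carrier ?P" "x - l * y \<in> I" by blast
      \<comment> \<open>Taking the degree \<open>d\<close> component of \<open>x - l * y\<close>
        stays in \<open>I\<close>, fixes \<open>x\<close> and replaces \<open>y\<close> by
        \<open>z\<close>.\<close>
      define z where "z = hcomp (d - 1) y"
      have z: "z \<in> forms n (d - 1)" using hcomp_in_forms[OF y(1)] by (simp add: z_def)
      have "hcomp d (x - l * y) = x - l * z"
        using hcomp_mult[of l 1 d y] assms(2,3) hcomp_forms[OF x, of d]
        by (simp add: hcomp_diff z_def forms_def)
      then have "x - l * z \<in> I" using hcomp_mem_homogeneous_ideal[OF assms(1) y(2), of d] by simp
      moreover have "l * z \<in> forms n d" using forms_mult[OF assms(2) z] assms(3) by simp
      then have "x - l * z \<in> forms n d" using mp.subspace_diff[OF subspace_forms x] by blast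
      ultimately have "(x - l * z) + l * z \<in> I \<inter> forms n d + (*) l ` forms n (d - 1)"
        using z by (intro set_plus_intro) auto
      then show "x \<in> I \<inter> forms n d + (*) l ` forms n (d - 1)" by simp
    next
      assume "x \<in> I \<inter> forms n d + (*) l ` forms n (d - 1)"
      then obtain w y where "w \<in> I" "y \<in> forms n (d - 1)" "x = w + l * y"
        by (auto simp: set_plus_def)
      then show "\<exists>y \<in> carrier ?P. x - l * y \<in> I"
        using forms_subset_carrier by (intro bexI[of _ y]) auto
    qed
    finally show ?thesis .
  qed
  moreover have "I \<inter> forms n d + (*) l ` forms n (d - 1) \<subseteq> forms n d"
    using section_subset[of "I \<inter> forms n d" n "d - 1" l] assms(2,3) by simp
  ultimately have "{u \<in> forms n d. ?h u = ?J} = I \<inter> forms n d + (*) l ` forms n (d - 1)" by blast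
  then show ?thesis
    using ring_dim_image[OF J.quotient_is_ring h subspace_forms forms_subset_carrier finite_dim_forms, of d]
    by (simp add: dim_section_part_def std_alg_def std_alg_scalars_def std_alg_part_def quot_image_def
        codim_def zero_FactRing image_image Let_def)
qed

section \<open>Transfer to standard graded algebras\<close>

theorem theorem1p20:
  fixes n d :: nat and I :: "'k::field mpoly set"
  assumes "homogeneous_ideal n I"
    and "d > 0"
  shows "\<exists>LS. finite LS \<and>
           (\<forall>L \<in> LS. linear_subspace (std_alg n I) (std_alg_scalars n I) L \<and>
                     L \<subset> std_alg_part n I 1) \<and>
           (\<forall>l \<in> std_alg_part n I 1. l \<notin> \<Union>LS \<longrightarrow>
              dim_section_part n I l d \<le> macaulay_lower d (dim_part n I d))"
proof -
  interpret I: ideal I "mpoly_ring n" using assms(1) by (rule homogeneous_ideal_imp_ideal)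
  let ?P = "mpoly_ring n :: 'k mpoly ring"
  let ?q = "\<lambda>x. I +>\<^bsub>?P\<^esub> x"
  interpret q: ring_hom_ring ?P "?P Quot I" ?q by (rule I.rcos_ring_hom_ring)
  have sub: "mp.subspace (I \<inter> forms n j)" for j
    by (intro mp.subspace_inter subspace_ideal[OF I.is_ideal] subspace_forms)
  have prod: "v * w \<in> I \<inter> forms n d" if "v \<in> I \<inter> forms n 1" "w \<in> forms n (d - 1)" for v w
    using that I.I_r_closed[of v w] forms_mult[of v n 1 w "d - 1"] forms_subset_carrier assms(2) by auto
  have "\<exists>LS. proper_cover n (I \<inter> forms n 1) LS \<and> (\<forall>l \<in> forms n 1 - \<Union>LS.
      codim n d (I \<inter> forms n d + (*) l ` forms n (d - 1))
        \<le> macaulay_lower d (codim n d (I \<inter> forms n d)))"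
    using assms(2) sub prod by (intro hyperplane_restriction) blast+
  then obtain LS where LS: "proper_cover n (I \<inter> forms n 1) LS"
    "\<And>l. l \<in> forms n 1 \<Longrightarrow> l \<notin> \<Union>LS \<Longrightarrow> codim n d (I \<inter> forms n d + (*) l ` forms n (d - 1))
       \<le> macaulay_lower d (codim n d (I \<inter> forms n d))"
    by blast
  show ?thesis
  proof (intro exI conjI ballI impI)
    show "finite ((`) ?q ` LS)" using LS(1) by (simp add: proper_cover_def)
  next
    fix L' assume "L' \<in> (`) ?q ` LS"
    then obtain L where L: "mp.subspace L" "I \<inter> forms n 1 \<subseteq> L" "L \<subset> forms n 1" "L' = ?q ` L"
      using LS(1) by (auto simp: proper_cover_def)
    have Lc: "L \<subseteq> carrier ?P" using L(3) forms_subset_carrier by blast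
    show "linear_subspace (std_alg n I) (std_alg_scalars n I) L'"
      unfolding linear_subspace_def
    proof (intro conjI ballI)
      show "subgroup L' (add_monoid (std_alg n I))"
        unfolding L(4) std_alg_def
        by (rule q.img_is_add_subgroup[OF subspace_imp_subgroup[OF L(1) Lc]])
      fix k v assume "k \<in> std_alg_scalars n I" "v \<in> L'"
      then obtain c u where cu: "k = ?q (Poly_Mapping.single 0 c)" "u \<in> L" "v = ?q u"
        by (auto simp: std_alg_scalars_def quot_image_def L(4))
      have "k \<otimes>\<^bsub>std_alg n I\<^esub> v = ?q (mscale c u)"
        using q.hom_mult[OF single_0_in_carrier, of u c] cu Lc by (auto simp: std_alg_def mscale_def)
      then show "k \<otimes>\<^bsub>std_alg n I\<^esub> v \<in> L'"
        using mp.subspace_scale[OF L(1) cu(2)] by (simp add: L(4))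
    qed
    obtain x where x: "x \<in> forms n 1" "x \<notin> L" using L(3) by blast
    \<comment> \<open>Properness survives the quotient because \<open>L\<close> contains the degree
      one part of \<open>I\<close>: a form congruent to an element of \<open>L\<close> already lies
      in \<open>L\<close>.\<close>
    have "?q x \<notin> L'"
    proof
      assume "?q x \<in> L'"
      then obtain y where y: "y \<in> L" "?q x = ?q y" by (auto simp: L(4))
      have "y \<in> forms n 1" using y L(3) by blast
      then have "x - y \<in> I"
        using coset_eq_iff[OF I.is_ideal, of x y] x y forms_subset_carrier by blast
      moreover have "x - y \<in> forms n 1"
        using mp.subspace_diff[OF subspace_forms x(1) \<open>y \<in> forms n 1\<close>] .
      ultimately have "x - y \<in> L" using L(2) by blast
      then show False using mp.subspace_add[OF L(1), of "x - y" y] y(1) x(2) by simp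
    qed
    then show "L' \<subset> std_alg_part n I 1"
      using L(3,4) x(1) by (auto simp: std_alg_part_def quot_image_def)
  next
    fix l' assume "l' \<in> std_alg_part n I 1" "l' \<notin> \<Union>((`) ?q ` LS)"
    \<comment> \<open>Any representative works: if it lay in some member of \<open>LS\<close>, then
      \<open>l'\<close> would lie in the image of that member.\<close>
    then obtain l where l: "l \<in> forms n 1" "l \<notin> \<Union>LS" "l' = ?q l"
      by (auto simp: std_alg_part_def quot_image_def)
    show "dim_section_part n I l' d \<le> macaulay_lower d (dim_part n I d)"
      unfolding l(3) dim_section_part_eq[OF assms(1) l(1) assms(2)] dim_part_eq[OF assms(1)]
      by (intro LS(2) l)
  qed
qed

end
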